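(* For every positive integer $m$ and all $w_1,w_2\in y\mathcal{H}$, \[ \sum_{\substack{a,b\ge1\\ a+b=m}}Z^\diamondsuit(\phi(w_1)\circledast y^a)\,Z^\diamondsuit(\phi(w_2)\circledast y^b)=Z^\diamondsuit(\phi(w_1*w_2)\circledast y^m), \] where the product on the left is the termwise product of sequences in $\mathbb{Q}^{\mathbb{N}}$.
   Context: $[n]=\{1,\dots,n\}$. For $N\ge1$ and an admissible index (tuple of positive integers, nonempty, last entry $\ge2$) $\boldsymbol{k}=(k_1,\dots,k_r)$: $[r]^1_{\boldsymbol{k}}=\{i:k_i=1\}$, $S_{r,N}(A)=\{(n_1,\dots,n_r)\in[N-1]^r: n_i\le n_{i+1}\ (i\in A),\ n_i<n_{i+1}\ (i\in[r-1]\setminus A)\}$, $\zeta^\diamondsuit_N(\boldsymbol{k})=\sum_{A\subset[r]^1_{\boldsymbol{k}}}\sum_{S_{r,N}(A)}\prod_{i\in A}(N-n_i)^{-1}\prod_{i\notin A}n_i^{-k_i}$, $\zeta^\diamondsuit(\boldsymbol{k})=(\zeta^\diamondsuit_N(\boldsymbol{k}))_{N\ge1}$. $\mathcal{H}=\mathbb{Q}\langle x,y\rangle$, $\mathcal{H}^1=\mathbb{Q}+y\mathcal{H}$, $\mathcal{H}^0=\mathbb{Q}+y\mathcal{H}x$, $e_k=yx^{k-1}$; $Z^\diamondsuit\colon\mathcal{H}^0\to\mathbb{Q}^{\mathbb{N}}$ is $\mathbb{Q}$-linear, $Z^\diamondsuit(1)=(1)_N$, $Z^\diamondsuit(e_{k_1}\cdots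 e_{k_r})=\zeta^\diamondsuit(k_1,\dots,k_r)$. $\phi$ is the algebra automorphism of $\mathcal{H}$ with $\phi(x)=x+y$, $\phi(y)=-y$. Harmonic product $*$ on $\mathcal{H}^1$: $\mathbb{Q}$-bilinear, $w*1=1*w=w$, $w_1e_{k_1}*w_2e_{k_2}=(w_1*w_2e_{k_2})e_{k_1}+(w_1e_{k_1}*w_2)e_{k_2}+(w_1*w_2)e_{k_1+k_2}$ for words $w_1,w_2\in\mathcal{H}^1$. The $\mathbb{Q}$-bilinear product $\circledast$ on $y\mathcal{H}$ is $w_1e_{k_1}\circledast w_2e_{k_2}=(w_1*w_2)e_{k_1+k_2}$ for words $w_1,w_2\in\mathcal{H}^1$ and positive integers $k_1,k_2$. *)

theory Defs
  imports Complex_Main "HOL-Library.Poly_Mapping"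
begin

section \<open>The algebra H = Q<x,y> as finitely supported functions on words\<close>

datatype letter = X | Y

type_synonym word = "letter list"
type_synonym H = "word \<Rightarrow>\<^sub>0 rat"

definition linext :: "('a \<Rightarrow> ('b \<Rightarrow>\<^sub>0 rat)) \<Rightarrow> ('a \<Rightarrow>\<^sub>0 rat) \<Rightarrow> ('b \<Rightarrow>\<^sub>0 rat)" where
  "linext f p = (\<Sum>u\<in>Poly_Mapping.keys p. Poly_Mapping.map (\<lambda>c. Poly_Mapping.lookup p u * c) (f u))"

definition bilinext :: "('a \<Rightarrow> 'b \<Rightarrow> ('c \<Rightarrow>\<^sub>0 rat)) \<Rightarrow> ('a \<Rightarrow>\<^sub>0 rat) \<Rightarrow> ('b \<Rightarrow>\<^sub>0 rat) \<Rightarrow> ('c \<Rightarrow>\<^sub>0 rat)" where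
  "bilinext f p q = (\<Sum>u\<in>Poly_Mapping.keys p. \<Sum>v\<in>Poly_Mapping.keys q.
      Poly_Mapping.map (\<lambda>c. Poly_Mapping.lookup p u * Poly_Mapping.lookup q v * c) (f u v))"

definition Hmult :: "H \<Rightarrow> H \<Rightarrow> H" where
  "Hmult p q = bilinext (\<lambda>u v. Poly_Mapping.single (u @ v) 1) p q"

definition yH :: "H set" where
  "yH = {p. \<forall>w\<in>Poly_Mapping.keys p. w \<noteq> [] \<and> hd w = Y}"

definition ypow :: "nat \<Rightarrow> H" where
  "ypow a = Poly_Mapping.single (replicate a Y) 1"

fun phi_letter :: "letter \<Rightarrow> H" where
  "phi_letter X = Poly_Mapping.single [X] 1 + Poly_Mapping.single [Y] 1"
| "phi_letter Y = Poly_Mapping.single [Y] (-1)"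

fun phi_word :: "word \<Rightarrow> H" where
  "phi_word [] = Poly_Mapping.single [] 1"
| "phi_word (a # w) = Hmult (phi_letter a) (phi_word w)"

definition phi :: "H \<Rightarrow> H" where
  "phi p = linext phi_word p"

definition word_of_idx :: "nat list \<Rightarrow> word" where
  "word_of_idx ks = concat (map (\<lambda>k. Y # replicate (k - 1) X) ks)"

text \<open>Inverse on words of H^1 (words that are empty or start with y).\<close>
function idx :: "word \<Rightarrow> nat list" where
  "idx [] = []"
| "idx (X # w) = idx w"
| "idx (Y # w) = (1 + length (takeWhile (\<lambda>c. c = X) w)) # idx (dropWhile (\<lambda>c. c = X) w)"
  by pat_completeness auto
termination
  by (relation "measure length") (auto simp: le_imp_less_Suc length_dropWhile_le)

text \<open>Prepend an entry to every index list (on reversed index lists this appends e_c).\<close>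
definition cons_all :: "nat \<Rightarrow> (nat list \<Rightarrow>\<^sub>0 rat) \<Rightarrow> (nat list \<Rightarrow>\<^sub>0 rat)" where
  "cons_all c p = linext (\<lambda>u. Poly_Mapping.single (c # u) 1) p"

text \<open>Harmonic product on REVERSED index lists:
  (w1 e_a) * (w2 e_b) = (w1 * w2 e_b) e_a + (w1 e_a * w2) e_b + (w1 * w2) e_(a+b).\<close>
function st :: "nat list \<Rightarrow> nat list \<Rightarrow> (nat list \<Rightarrow>\<^sub>0 rat)" where
  "st [] v = Poly_Mapping.single v 1"
| "st (a # u) [] = Poly_Mapping.single (a # u) 1"
| "st (a # u) (b # v) = cons_all a (st u (b # v)) + cons_all b (st (a # u) v)
      + cons_all (a + b) (st u v)"
  by pat_completeness auto
termination
  by (relation "measure (\<lambda>(u, v). length u + length v)") auto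

definition in_H1_word :: "word \<Rightarrow> bool" where
  "in_H1_word w \<longleftrightarrow> w = [] \<or> hd w = Y"

definition rev_idx_to_H :: "(nat list \<Rightarrow>\<^sub>0 rat) \<Rightarrow> H" where
  "rev_idx_to_H p = linext (\<lambda>ks. Poly_Mapping.single (word_of_idx (rev ks)) 1) p"

text \<open>Harmonic product of words of H^1 (value 0 outside H^1, where it is not defined).\<close>
definition harm_word :: "word \<Rightarrow> word \<Rightarrow> H" where
  "harm_word u v = (if in_H1_word u \<and> in_H1_word v
      then rev_idx_to_H (st (rev (idx u)) (rev (idx v))) else 0)"

definition harm :: "H \<Rightarrow> H \<Rightarrow> H" where
  "harm p q = bilinext harm_word p q"

text \<open>w1 e_k1 circledast w2 e_k2 = (w1 * w2) e_(k1+k2), on reversed index lists.\<close>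
fun circ_rev :: "nat list \<Rightarrow> nat list \<Rightarrow> (nat list \<Rightarrow>\<^sub>0 rat)" where
  "circ_rev (a # u) (b # v) = cons_all (a + b) (st u v)"
| "circ_rev _ _ = 0"

text \<open>circledast on words of yH (value 0 outside yH, where it is not defined).\<close>
definition circ_word :: "word \<Rightarrow> word \<Rightarrow> H" where
  "circ_word u v = (if u \<noteq> [] \<and> hd u = Y \<and> v \<noteq> [] \<and> hd v = Y
      then rev_idx_to_H (circ_rev (rev (idx u)) (rev (idx v))) else 0)"

definition circ :: "H \<Rightarrow> H \<Rightarrow> H" where
  "circ p q = bilinext circ_word p q"

text \<open>S_{r,N}(A), with n_i = ns ! (i - 1) (1-based indices).\<close>
definition S_set :: "nat \<Rightarrow> nat \<Rightarrow> nat set \<Rightarrow> nat list set" where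
  "S_set r N A = {ns. length ns = r \<and> set ns \<subseteq> {1..N - 1} \<and>
      (\<forall>i\<in>{1..r - 1}. (i \<in> A \<longrightarrow> ns ! (i - 1) \<le> ns ! i) \<and>
                       (i \<notin> A \<longrightarrow> ns ! (i - 1) < ns ! i))}"

definition zeta_diamond_N :: "nat list \<Rightarrow> nat \<Rightarrow> rat" where
  "zeta_diamond_N ks N =
     (let r = length ks in
      \<Sum>A\<in>Pow {i\<in>{1..r}. ks ! (i - 1) = 1}. \<Sum>ns\<in>S_set r N A.
         (\<Prod>i\<in>A. 1 / of_nat (N - ns ! (i - 1))) *
         (\<Prod>i\<in>{1..r} - A. 1 / (of_nat (ns ! (i - 1))) ^ (ks ! (i - 1))))"

definition in_H0_word :: "word \<Rightarrow> bool" where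
  "in_H0_word w \<longleftrightarrow> w = [] \<or> (hd w = Y \<and> last w = X)"

text \<open>Z^diamond on words (value 0 outside H^0, where it is not defined);
  sequences Q^N are functions nat \<Rightarrow> rat, only the indices N \<ge> 1 being meaningful.\<close>
definition Zd_word :: "word \<Rightarrow> nat \<Rightarrow> rat" where
  "Zd_word w N = (if w = [] then 1 else if in_H0_word w then zeta_diamond_N (idx w) N else 0)"

definition Zd :: "H \<Rightarrow> nat \<Rightarrow> rat" where
  "Zd p N = (\<Sum>w\<in>Poly_Mapping.keys p. Poly_Mapping.lookup p w * Zd_word w N)"

end

theory Submission
  imports Defs "HOL-Computational_Algebra.Formal_Laurent_Series"
begin

text \<open>
  Fix \<open>N\<close>, let \<open>z\<close> be an indeterminate and put \<open>s = N - z\<close>. Summing \<open>Z\<^sub>N(\<phi>(w) \<circledast> y\<^sup>m) z\<^sup>m\<close> over \<open>m \<ge> 1\<close>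
  gives a finite analogue \<open>F\<^sub>w\<close> of the Kawashima function, and the claim says
  \<open>F\<^sub>v F\<^sub>w = F\<^bsub>v * w\<^esub>\<close>. Absorbing the powers of \<open>y\<close> turns \<open>F\<^sub>w\<close> into \<open>\<Sum>\<^sub>n K(n) H\<^sub>w(n)\<close>, where the kernel
  \<open>K(n) = (-1)\<^sup>n p\<^sup>\<down>\<^sup>n (s-1-p)\<^sup>\<down>\<^sup>n / (n! (s-1)\<^sup>\<down>\<^sup>n)\<close> (with falling factorials and \<open>p = N - 1\<close>) does not
  involve \<open>w\<close>, and the inner sum \<open>H\<^sub>w\<close> depends on \<open>N\<close> and \<open>z\<close> only through \<open>s\<close>. Now vary \<open>p\<close> with
  \<open>s\<close> fixed: the difference of the kernels for \<open>p\<close> and \<open>p - 1\<close> is an eigenvector, with eigenvalue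
  \<open>1/(p(s-p))\<close>, of the adjoint of the operator \<open>f \<mapsto> (n \<mapsto> 1/n \<Sum>\<^bsub>j\<le>n\<^esub> f(j)/(s-j))\<close> that builds \<open>H\<^sub>w\<close>.
  Hence passing from \<open>p - 1\<close> to \<open>p\<close> multiplies \<open>F\<close>, in the convolution algebra of functionals on the
  harmonic algebra, by \<open>\<chi>\<^bsub>1/(s-p)\<^esub>\<^sup>-\<^sup>1 \<chi>\<^bsub>1/p\<^esub>\<close>, where \<open>\<chi>\<^sub>x\<close> is the character with \<open>\<chi>\<^sub>x(e\<^sub>k) = x\<^sup>k\<close> that kills
  all words of depth at least two. So \<open>F\<close> is a product of characters, hence a character.
\<close>

section \<open>Linear functionals and characters of the harmonic algebra\<close>

definition lin :: "('a \<Rightarrow> 'b::field_char_0) \<Rightarrow> ('a \<Rightarrow>\<^sub>0 rat) \<Rightarrow> 'b" where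
  "lin f p = (\<Sum>w\<in>Poly_Mapping.keys p. of_rat (Poly_Mapping.lookup p w) * f w)"

lemma lin_superset:
  assumes "finite S" "Poly_Mapping.keys p \<subseteq> S"
  shows "lin f p = (\<Sum>w\<in>S. of_rat (Poly_Mapping.lookup p w) * f w)"
  unfolding lin_def by (rule sum.mono_neutral_left) (use assms in \<open>auto simp: in_keys_iff\<close>)

lemma lin_zero [simp]: "lin f 0 = 0"
  by (simp add: lin_def)

lemma lin_single [simp]: "lin f (Poly_Mapping.single w c) = of_rat c * f w"
  by (cases "c = 0") (auto simp: lin_def)

lemma lin_zero_fun [simp]: "lin (\<lambda>w. 0) p = 0"
  by (simp add: lin_def)

lemma lin_add [simp]: "lin f (p + q) = lin f p + lin f q"
proof -
  let ?S = "Poly_Mapping.keys p \<union> Poly_Mapping.keys q"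
  have "Poly_Mapping.keys (p + q) \<subseteq> ?S"
    by (rule Poly_Mapping.keys_add)
  then show ?thesis
    using lin_superset[of ?S p f] lin_superset[of ?S q f] lin_superset[of ?S "p + q" f]
    by (simp add: lookup_add of_rat_add ring_distribs sum.distrib)
qed

lemma lin_sum: "lin f (sum g I) = (\<Sum>i\<in>I. lin f (g i))"
  by (induction I rule: infinite_finite_induct) auto

lemma lin_scale [simp]: "lin f (Poly_Mapping.map (\<lambda>x. c * x) p) = of_rat c * lin f p"
proof -
  have "lin f (Poly_Mapping.map (\<lambda>x. c * x) p) =
      (\<Sum>w\<in>Poly_Mapping.keys p. of_rat (Poly_Mapping.lookup (Poly_Mapping.map (\<lambda>x. c * x) p) w) * f w)"
    by (rule lin_superset) (auto simp: in_keys_iff Poly_Mapping.map.rep_eq)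
  also have "\<dots> = of_rat c * lin f p"
    unfolding lin_def sum_distrib_left
    by (rule sum.cong) (auto simp: Poly_Mapping.map.rep_eq of_rat_mult in_keys_iff)
  finally show ?thesis .
qed

lemma lin_linext: "lin f (linext g p) = lin (\<lambda>u. lin f (g u)) p"
  unfolding linext_def by (simp add: lin_sum lin_def[of "\<lambda>u. lin f (g u)"])

lemma lin_bilinext: "lin f (bilinext g p q) = lin (\<lambda>u. lin (\<lambda>v. lin f (g u v)) q) p"
  unfolding bilinext_def
  by (simp add: lin_sum lin_def[of _ p] lin_def[of _ q] sum_distrib_left of_rat_mult mult.assoc)

lemma lin_add_fun: "lin (\<lambda>w. f w + g w) p = lin f p + lin g p"
  by (simp add: lin_def ring_distribs sum.distrib)

lemma lin_mult_left: "lin (\<lambda>w. c * f w) p = c * lin f p"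
  by (simp add: lin_def sum_distrib_left mult.left_commute)

lemma lin_uminus_fun: "lin (\<lambda>w. - f w) p = - lin f p"
  using lin_mult_left[of "-1" f p] by simp

lemma lin_diff_fun: "lin (\<lambda>w. f w - g w) p = lin f p - lin g p"
  using lin_add_fun[of f "\<lambda>w. - g w" p] by (simp add: lin_uminus_fun)

lemma lin_mult_right: "lin (\<lambda>w. f w * c) p = lin f p * c"
  by (simp add: lin_def sum_distrib_right mult.assoc)

lemma lin_divide: "lin (\<lambda>w. f w / c) p = lin f p / c"
  using lin_mult_right[of f "inverse c" p] by (simp add: field_simps)

lemma lin_sum_fun: "lin (\<lambda>w. \<Sum>i\<in>I. f i w) p = (\<Sum>i\<in>I. lin (f i) p)"
  unfolding lin_def sum_distrib_left by (rule sum.swap)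

lemma lin_cong_keys:
  "(\<And>w. w \<in> Poly_Mapping.keys p \<Longrightarrow> f w = g w) \<Longrightarrow> lin f p = lin g p"
  by (simp add: lin_def)

lemma lin_cons_all: "lin f (cons_all c p) = lin (\<lambda>u. f (c # u)) p"
  by (simp add: cons_all_def lin_linext)

lemma lin_rev_idx_to_H: "lin f (rev_idx_to_H p) = lin (\<lambda>ks. f (word_of_idx (rev ks))) p"
  by (simp add: rev_idx_to_H_def lin_linext)

lemma Zd_eq_lin: "Zd p N = lin (\<lambda>w. Zd_word w N) p"
  by (simp add: Zd_def lin_def)

definition harm_char :: "(nat list \<Rightarrow> 'b::field_char_0) \<Rightarrow> bool" where
  "harm_char f \<longleftrightarrow> f [] = 1 \<and> (\<forall>u v. lin f (st u v) = f u * f v)"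

lemma lin_st_cons:
  "lin f (st (a # u) (b # v)) = lin (\<lambda>w. f (a # w)) (st u (b # v)) +
     lin (\<lambda>w. f (b # w)) (st (a # u) v) + lin (\<lambda>w. f ((a + b) # w)) (st u v)"
  by (simp add: lin_cons_all)

lemma lin_st_Nil [simp]: "lin f (st u []) = f u" "lin f (st [] u) = f u"
  by (cases u; simp)+

text \<open>No product with a nonempty factor contains the empty list. This is the unit of
  convolution, where the product of characters starts.\<close>

lemma harm_char_indicator: "harm_char (\<lambda>u. if u = [] then 1 else (0::'b::field_char_0))"
  (is "harm_char ?f")
proof -
  have "lin ?f (st u v) = ?f u * ?f v" for u v
  proof (cases u; cases v)
    fix a u' b v' assume "u = a # u'" "v = b # v'"
    then show ?thesis by (simp add: lin_st_cons del: st.simps)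
  qed (simp_all del: st.simps)
  then show ?thesis by (simp add: harm_char_def)
qed

text \<open>The convolution on the right with the character sending a depth one index \<open>k\<close> to \<open>x\<^sup>k\<close>
  and all indices of larger depth to zero.\<close>

lemma harm_char_step:
  fixes f g :: "nat list \<Rightarrow> 'b::field_char_0"
  assumes f: "harm_char f" and g: "g [] = 1" "\<And>k u. g (k # u) = f (k # u) + x ^ k * f u"
  shows "harm_char g"
proof -
  have mult: "lin f (st u v) = f u * f v" for u v using f by (auto simp: harm_char_def)
  have "lin g (st u v) = g u * g v" for u v
  proof (cases u; cases v)
    fix a u' b v' assume uv: "u = a # u'" "v = b # v'"
    have "lin g (st u v) = lin f (st (a # u') (b # v')) + x ^ a * lin f (st u' (b # v')) +
        x ^ b * lin f (st (a # u') v') + x ^ (a + b) * lin f (st u' v')"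
      unfolding uv lin_st_cons g by (simp add: lin_add_fun lin_mult_left del: st.simps)
    then show ?thesis unfolding mult uv g by (simp add: algebra_simps power_add)
  qed (simp_all add: g del: st.simps)
  then show ?thesis using g by (simp add: harm_char_def)
qed

text \<open>The convolution inverse of the previous operation.\<close>

lemma harm_char_inverse_step:
  fixes f g :: "nat list \<Rightarrow> 'b::field_char_0"
  assumes f: "harm_char f" and g: "g [] = 1" "\<And>k u. g (k # u) = f (k # u) - x ^ k * g u"
  shows "harm_char g"
proof -
  have mult: "lin f (st u v) = f u * f v" for u v using f by (auto simp: harm_char_def)
  have "lin g (st u v) = g u * g v" for u v
  proof (induction u v rule: st.induct)
    case (3 a u b v)
    have "lin g (st (a # u) (b # v)) = lin f (st (a # u) (b # v)) - x ^ a * lin g (st u (b # v)) -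
        x ^ b * lin g (st (a # u) v) - x ^ (a + b) * lin g (st u v)"
      unfolding lin_st_cons g by (simp add: lin_diff_fun lin_mult_left del: st.simps)
    then show ?case unfolding mult 3 g by (simp add: algebra_simps power_add)
  qed (simp_all add: g del: st.simps)
  then show ?thesis using g by (simp add: harm_char_def)
qed

text \<open>Every list in the product of two lists of positive entries has positive entries, and it
  is empty only if both factors are.\<close>

lemma lin_st_cong:
  assumes "\<And>w. \<lbrakk>0 \<notin> set w; u \<noteq> [] \<or> v \<noteq> [] \<Longrightarrow> w \<noteq> []\<rbrakk> \<Longrightarrow> f w = g w" "0 \<notin> set u" "0 \<notin> set v"
  shows "lin f (st u v) = lin g (st u v)"
  using assms
proof (induction u v arbitrary: f g rule: st.induct)
  case (3 a u b v)
  show ?case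
    unfolding lin_st_cons
    by (intro arg_cong2[where f = "(+)"] "3.IH" "3.prems"(1)) (use 3(5,6) in auto)
qed (simp_all del: st.simps)

section \<open>Words, indices and the automorphism\<close>

lemma word_of_idx_snoc: "word_of_idx (ks @ [k]) = word_of_idx ks @ Y # replicate (k - 1) X"
  by (simp add: word_of_idx_def)

lemma takeWhile_dropWhile_word_of_idx:
  "takeWhile (\<lambda>c. c = X) (replicate k X @ word_of_idx ks) = replicate k X"
  "dropWhile (\<lambda>c. c = X) (replicate k X @ word_of_idx ks) = word_of_idx ks"
  by (induction k) (cases ks; simp add: word_of_idx_def)+

lemma idx_word_of_idx: "0 \<notin> set ks \<Longrightarrow> idx (word_of_idx ks) = ks"
proof (induction ks)
  case (Cons k ks)
  have "word_of_idx (k # ks) = Y # replicate (k - 1) X @ word_of_idx ks"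
    by (simp add: word_of_idx_def)
  with Cons show ?case by (simp add: takeWhile_dropWhile_word_of_idx)
qed (simp add: word_of_idx_def)

lemma zero_notin_idx: "0 \<notin> set (idx w)"
  by (induction w rule: idx.induct) auto

lemma word_of_idx_idx: "in_H1_word w \<Longrightarrow> word_of_idx (idx w) = w"
proof (induction w rule: idx.induct)
  case (3 w)
  have "in_H1_word (dropWhile (\<lambda>c. c = X) w)"
    using hd_dropWhile[of "\<lambda>c. c = X" w] by (auto simp: in_H1_word_def intro: letter.exhaust)
  with 3 have "word_of_idx (idx (Y # w)) = Y # replicate (length (takeWhile (\<lambda>c. c = X) w)) X @ dropWhile (\<lambda>c. c = X) w"
    by (simp add: word_of_idx_def)
  also have "replicate (length (takeWhile (\<lambda>c. c = X) w)) X = takeWhile (\<lambda>c. c = X) w"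
    by (induction w) auto
  finally show ?case by simp
qed (auto simp: in_H1_word_def word_of_idx_def)

text \<open>Reversal puts the last entry at the head: appending \<open>Y\<close> to a word conses an
  entry 1, appending \<open>X\<close> raises the head by one.\<close>

abbreviation ridx :: "word \<Rightarrow> nat list" where "ridx w \<equiv> rev (idx w)"

lemma in_H1_word_of_idx: "in_H1_word (word_of_idx ks)"
  by (cases ks) (auto simp: in_H1_word_def word_of_idx_def)

lemma word_of_idx_eq_Nil_iff: "word_of_idx ks = [] \<longleftrightarrow> ks = []"
  by (cases ks) (auto simp: word_of_idx_def)

lemma ridx_snoc_Y: "in_H1_word w \<Longrightarrow> ridx (w @ [Y]) = 1 # ridx w"
  using idx_word_of_idx[of "idx w @ [1]"]
  by (simp add: word_of_idx_snoc word_of_idx_idx zero_notin_idx)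

lemma ridx_snoc_X:
  assumes "in_H1_word w" "w \<noteq> []"
  obtains k u where "ridx w = k # u" "0 < k" "0 \<notin> set u" "ridx (w @ [X]) = Suc k # u"
proof -
  have "idx w \<noteq> []" using assms word_of_idx_idx[of w] by (auto simp: word_of_idx_def)
  then obtain ks k where k: "idx w = ks @ [k]" by (metis rev_exhaust)
  have pos: "0 < k" "0 \<notin> set ks" using zero_notin_idx[of w] k by auto
  then obtain l where l: "k = Suc l" using gr0_implies_Suc by auto
  have "word_of_idx (ks @ [Suc k]) = w @ [X]"
    using word_of_idx_idx[OF assms(1)] k l
    by (auto simp: word_of_idx_snoc replicate_append_same)
  then have "idx (w @ [X]) = ks @ [Suc k]"
    using idx_word_of_idx[of "ks @ [Suc k]"] pos by simp
  with that[of k "rev ks"] k pos show ?thesis by simp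
qed

lemma lin_phi_word_Cons:
  "lin f (phi_word (X # w)) = lin (\<lambda>v. f (X # v)) (phi_word w) + lin (\<lambda>v. f (Y # v)) (phi_word w)"
  "lin f (phi_word (Y # w)) = - lin (\<lambda>v. f (Y # v)) (phi_word w)"
  by (simp_all add: Hmult_def lin_bilinext of_rat_minus)

text \<open>\<open>phi_word\<close> recurses on the first letter, the iterated sums on the last
  entry; as \<phi> is multiplicative, the last letter splits off as well.\<close>

lemma lin_phi_word_snoc:
  "lin f (phi_word (w @ [X])) = lin (\<lambda>v. f (v @ [X])) (phi_word w) + lin (\<lambda>v. f (v @ [Y])) (phi_word w)"
  "lin f (phi_word (w @ [Y])) = - lin (\<lambda>v. f (v @ [Y])) (phi_word w)"
proof (induction w arbitrary: f)
  case Nil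
  {
    case 1 show ?case using lin_phi_word_Cons(1)[of f "[]"] by simp
  next
    case 2 show ?case using lin_phi_word_Cons(2)[of f "[]"] by simp
  }
next
  case (Cons a w)
  {
    case 1 show ?case using Cons by (cases a) (simp_all add: lin_phi_word_Cons del: phi_word.simps)
  next
    case 2 show ?case using Cons by (cases a) (simp_all add: lin_phi_word_Cons del: phi_word.simps)
  }
qed

text \<open>Since \<phi>(y) = -y, the image of a word starting with \<open>Y\<close> involves only
  words starting with \<open>Y\<close>.\<close>

lemma lin_phi_word_cong:
  assumes "\<And>v. in_H1_word v \<Longrightarrow> (w \<noteq> [] \<Longrightarrow> v \<noteq> []) \<Longrightarrow> f v = g v" "in_H1_word w"
  shows "lin f (phi_word w) = lin g (phi_word w)"
proof (cases w)
  case (Cons a w')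
  then have "a = Y" using assms by (auto simp: in_H1_word_def)
  moreover have "(\<lambda>v. f (Y # v)) = (\<lambda>v. g (Y # v))"
    using assms by (auto simp: in_H1_word_def)
  ultimately show ?thesis using Cons by (simp add: lin_phi_word_Cons del: phi_word.simps)
qed (use assms in \<open>auto simp: in_H1_word_def\<close>)

section \<open>The kernel and its eigenvector property\<close>

text \<open>\<open>kker\<close> is the kernel K(n), given by the ratio of consecutive terms. For
  \<open>p \<noteq> 0\<close> and \<open>s \<noteq> p\<close>,
  \<open>kker s p n - kker s (p - 1) n = (s - 2 * p) * n * jker s p n\<close>.\<close>

fun jker kker :: "'b::field_char_0 \<Rightarrow> 'b \<Rightarrow> nat \<Rightarrow> 'b" where
  "jker s p 0 = 1 / (p * (s - p))"
| "jker s p (Suc n) = - jker s p n * (p - of_nat n) * (s - p - of_nat n) /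
     (of_nat (Suc n) * (s - of_nat (Suc n)))"
| "kker s p 0 = 1"
| "kker s p (Suc n) = - kker s p n * (p - of_nat n) * (s - 1 - p - of_nat n) /
     (of_nat (Suc n) * (s - of_nat (Suc n)))"

lemma kker_eq_jker:
  assumes "p \<noteq> 0" "s \<noteq> p"
  shows "kker s p n = jker s p n * p * (s - p - of_nat n)"
proof (induction n)
  case (Suc n)
  have "kker s p (Suc n) = - (jker s p n * p * (s - p - of_nat n)) * (p - of_nat n) * (s - 1 - p - of_nat n) /
     (of_nat (Suc n) * (s - of_nat (Suc n)))"
    by (simp only: kker.simps Suc)
  also have "\<dots> = jker s p (Suc n) * p * (s - p - of_nat (Suc n))"
    by (simp add: algebra_simps)
  finally show ?case .
qed (use assms in simp)

lemma kker_pred_eq_jker: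
  assumes "p \<noteq> 0" "s \<noteq> p"
  shows "kker s (p - 1) n = jker s p n * (p - of_nat n) * (s - p)"
proof (induction n)
  case (Suc n)
  have "kker s (p - 1) (Suc n) = - (jker s p n * (p - of_nat n) * (s - p)) * (p - 1 - of_nat n) * (s - p - of_nat n) /
     (of_nat (Suc n) * (s - of_nat (Suc n)))"
    by (simp only: kker.simps Suc) simp
  also have "\<dots> = jker s p (Suc n) * (p - of_nat (Suc n)) * (s - p)"
    by (simp add: algebra_simps)
  finally show ?case .
qed (use assms in simp)

lemma jker_eq_0: "p < n \<Longrightarrow> jker s (of_nat p) n = 0"
proof (induction n)
  case (Suc n)
  then show ?case by (cases "p = n") auto
qed simp

text \<open>The identity \<open>(p - n) * (s - p - n) = p * (s - p) - n * (s - n)\<close> makes the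
  sum telescope in the quantities \<open>n * (s - n) * jker s p n\<close>.\<close>

lemma sum_jker:
  assumes s: "\<And>i. s \<noteq> of_nat i" and "p \<noteq> 0" "s \<noteq> p" "j \<le> m"
  shows "p * (s - p) * (\<Sum>n = j..<m. jker s p n) =
    of_nat j * (s - of_nat j) * jker s p j - of_nat m * (s - of_nat m) * jker s p m"
  using \<open>j \<le> m\<close>
proof (induction m rule: dec_induct)
  case (step m)
  have "of_nat (Suc m) * (s - of_nat (Suc m)) \<noteq> 0"
    using s[of "Suc m"] by (simp del: of_nat_Suc)
  then have "of_nat (Suc m) * (s - of_nat (Suc m)) * jker s p (Suc m) =
      - jker s p m * (p - of_nat m) * (s - p - of_nat m)"
    by (simp del: of_nat_Suc)
  then have eq: "of_nat (Suc m) * (s - of_nat (Suc m)) * jker s p (Suc m) =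
      of_nat m * (s - of_nat m) * jker s p m - p * (s - p) * jker s p m"
    by (simp add: algebra_simps)
  have "p * (s - p) * (\<Sum>n = j..<Suc m. jker s p n) =
      p * (s - p) * (\<Sum>n = j..<m. jker s p n) + p * (s - p) * jker s p m"
    using \<open>j \<le> m\<close> by (simp add: distrib_left)
  then show ?case
    unfolding eq step.IH by simp
qed simp

text \<open>After interchanging the sums, the tail from \<open>j\<close> to \<open>p\<close>
  telescopes, and \<open>jker\<close> vanishes at \<open>p + 1\<close>. So
  \<open>n * jker s p n\<close> is the eigenvector of the adjoint.\<close>

lemma jker_adjoint:
  fixes s :: "'b::field_char_0"
  assumes s: "\<And>i. s \<noteq> of_nat i" and "0 < p"
  shows "of_nat p * (s - of_nat p) * (\<Sum>n = 1..p. jker s (of_nat p) n * (\<Sum>j = 1..n. f j / (s - of_nat j))) =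
    (\<Sum>j = 1..p. of_nat j * jker s (of_nat p) j * f j)"
proof -
  define P where "P = of_nat p * (s - of_nat p)"
  have tail: "P * (\<Sum>n = j..p. jker s (of_nat p) n) = of_nat j * (s - of_nat j) * jker s (of_nat p) j"
    if "j \<in> {1..p}" for j
    using sum_jker[of s "of_nat p" j "Suc p"] s[of p] s \<open>0 < p\<close> that jker_eq_0[of p "Suc p" s]
    unfolding P_def by (simp add: atLeastLessThanSuc_atLeastAtMost del: jker.simps)
  have "(\<Sum>n = 1..p. jker s (of_nat p) n * (\<Sum>j = 1..n. f j / (s - of_nat j))) =
      (\<Sum>n = 1..p. \<Sum>j = 1..n. jker s (of_nat p) n * (f j / (s - of_nat j)))"
    by (simp add: sum_distrib_left)
  also have "\<dots> = (\<Sum>j = 1..p. \<Sum>n = j..p. jker s (of_nat p) n * (f j / (s - of_nat j)))"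
    unfolding sum.Sigma[OF finite_atLeastAtMost ballI[OF finite_atLeastAtMost]]
    by (rule sum.reindex_bij_witness[of _ "\<lambda>(a, b). (b, a)" "\<lambda>(a, b). (b, a)"]) auto
  also have "P * \<dots> = (\<Sum>j = 1..p. P * (\<Sum>n = j..p. jker s (of_nat p) n) * (f j / (s - of_nat j)))"
    by (simp add: sum_distrib_left sum_distrib_right sum_divide_distrib mult.assoc)
  also have "\<dots> = (\<Sum>j = 1..p. of_nat j * jker s (of_nat p) j * f j)"
    using s by (intro sum.cong refl) (simp add: tail)
  finally show ?thesis by (simp add: P_def)
qed

text \<open>In the first sum the term \<open>j = 0\<close> vanishes for \<open>k > 0\<close>, because \<open>1 / 0 = 0\<close>; the same
  convention is used in \<open>gsum\<close> and \<open>pprod\<close> below.\<close>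

fun qsum :: "'b::field_char_0 \<Rightarrow> nat list \<Rightarrow> nat \<Rightarrow> 'b" where
  "qsum s [] n = 1"
| "qsum s (k # u) n = (\<Sum>j<n. qsum s u j / of_nat j ^ k) +
     (if k = 1 then \<Sum>j=1..n. qsum s u j / (s - of_nat j) else 0)"

fun hterm :: "'b::field_char_0 \<Rightarrow> nat list \<Rightarrow> nat \<Rightarrow> 'b" where
  "hterm s [] n = 0"
| "hterm s (k # u) n = qsum s u n / of_nat n ^ k"

text \<open>Of the two sums over \<phi>(w), \<open>H\<phi>\<close> fixes the outermost variable at
  \<open>n\<close>, while \<open>Q\<phi>\<close> sums over it up to \<open>n\<close>.\<close>

definition Q\<phi> :: "'b::field_char_0 \<Rightarrow> word \<Rightarrow> nat \<Rightarrow> 'b" where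
  "Q\<phi> s w n = lin (\<lambda>v. qsum s (ridx v) n) (phi_word w)"

definition H\<phi> :: "'b::field_char_0 \<Rightarrow> word \<Rightarrow> nat \<Rightarrow> 'b" where
  "H\<phi> s w n = lin (\<lambda>v. hterm s (ridx v) n) (phi_word w)"

section \<open>Recurrences of the inner sums when a letter is appended\<close>

lemma sum_lessThan_eq_sum_from_1:
  fixes f :: "nat \<Rightarrow> 'b::comm_monoid_add"
  assumes "f 0 = 0"
  shows "(\<Sum>j<n. f j) = (\<Sum>j=1..<n. f j)"
  by (rule sum.mono_neutral_right) (auto simp: assms Suc_le_eq intro: gr0I)

text \<open>\<phi>(wx) = \<phi>(w)x + \<phi>(w)y: the first part raises the exponent of
  \<open>n\<close> by one, the second opens a new outermost variable \<open>n\<close> with exponent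
  1.\<close>

lemma H\<phi>_snoc_X:
  assumes "in_H1_word w" "w \<noteq> []"
  shows "H\<phi> s (w @ [X]) n = (H\<phi> s w n + Q\<phi> s w n) / of_nat n"
proof -
  have "H\<phi> s (w @ [X]) n =
      lin (\<lambda>v. hterm s (ridx (v @ [X])) n + hterm s (ridx (v @ [Y])) n) (phi_word w)"
    by (simp add: H\<phi>_def lin_phi_word_snoc lin_add_fun)
  also have "\<dots> = lin (\<lambda>v. (hterm s (ridx v) n + qsum s (ridx v) n) / of_nat n) (phi_word w)"
  proof (rule lin_phi_word_cong[OF _ assms(1)])
    fix v assume v: "in_H1_word v" "w \<noteq> [] \<Longrightarrow> v \<noteq> []"
    with assms obtain k u where "ridx v = k # u" "0 < k" "0 \<notin> set u" "ridx (v @ [X]) = Suc k # u"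
      using ridx_snoc_X by blast
    then show "hterm s (ridx (v @ [X])) n + hterm s (ridx (v @ [Y])) n =
        (hterm s (ridx v) n + qsum s (ridx v) n) / of_nat n"
      by (simp add: ridx_snoc_Y[OF v(1)] add_divide_distrib ac_simps del: qsum.simps)
  qed
  finally show ?thesis
    by (simp add: lin_divide lin_add_fun H\<phi>_def Q\<phi>_def)
qed

lemma H\<phi>_snoc_Y:
  assumes "in_H1_word w"
  shows "H\<phi> s (w @ [Y]) n = - Q\<phi> s w n / of_nat n"
proof -
  have "H\<phi> s (w @ [Y]) n = - lin (\<lambda>v. hterm s (ridx (v @ [Y])) n) (phi_word w)"
    by (simp add: H\<phi>_def lin_phi_word_snoc)
  also have "lin (\<lambda>v. hterm s (ridx (v @ [Y])) n) (phi_word w) = lin (\<lambda>v. qsum s (ridx v) n / of_nat n) (phi_word w)"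
    by (rule lin_phi_word_cong[OF _ assms]) (simp add: ridx_snoc_Y)
  finally show ?thesis
    by (simp add: lin_divide Q\<phi>_def)
qed

text \<open>The strict sums of \<phi>(w)x and \<phi>(w)y combine to \<open>H\<phi>\<close>. Only
  \<phi>(w)y has last entry 1, so it alone yields the sum with \<open>s - j\<close>.\<close>

lemma Q\<phi>_snoc_X:
  assumes "in_H1_word w" "w \<noteq> []"
  shows "Q\<phi> s (w @ [X]) n = (\<Sum>j=1..<n. H\<phi> s (w @ [X]) j) + (\<Sum>j=1..n. Q\<phi> s w j / (s - of_nat j))"
proof -
  have "Q\<phi> s (w @ [X]) n =
      lin (\<lambda>v. qsum s (ridx (v @ [X])) n + qsum s (ridx (v @ [Y])) n) (phi_word w)"
    by (simp add: Q\<phi>_def lin_phi_word_snoc lin_add_fun)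
  also have "\<dots> = lin (\<lambda>v. (\<Sum>j<n. hterm s (ridx (v @ [X])) j + hterm s (ridx (v @ [Y])) j) +
      (\<Sum>j=1..n. qsum s (ridx v) j / (s - of_nat j))) (phi_word w)"
  proof (rule lin_phi_word_cong[OF _ assms(1)])
    fix v assume v: "in_H1_word v" "w \<noteq> [] \<Longrightarrow> v \<noteq> []"
    with assms obtain k u where "ridx v = k # u" "0 < k" "0 \<notin> set u" "ridx (v @ [X]) = Suc k # u"
      using ridx_snoc_X by blast
    then show "qsum s (ridx (v @ [X])) n + qsum s (ridx (v @ [Y])) n =
        (\<Sum>j<n. hterm s (ridx (v @ [X])) j + hterm s (ridx (v @ [Y])) j) +
        (\<Sum>j=1..n. qsum s (ridx v) j / (s - of_nat j))"
      by (simp add: ridx_snoc_Y[OF v(1)] sum.distrib)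
  qed
  also have "\<dots> = (\<Sum>j<n. H\<phi> s (w @ [X]) j) + (\<Sum>j=1..n. Q\<phi> s w j / (s - of_nat j))"
    by (simp add: lin_divide lin_add_fun lin_sum_fun H\<phi>_def Q\<phi>_def lin_phi_word_snoc sum.distrib)
  also have "(\<Sum>j<n. H\<phi> s (w @ [X]) j) = (\<Sum>j=1..<n. H\<phi> s (w @ [X]) j)"
    by (rule sum_lessThan_eq_sum_from_1) (use assms in \<open>auto simp: H\<phi>_snoc_X\<close>)
  finally show ?thesis .
qed

lemma Q\<phi>_snoc_Y:
  assumes "in_H1_word w"
  shows "Q\<phi> s (w @ [Y]) n = (\<Sum>j=1..<n. H\<phi> s (w @ [Y]) j) - (\<Sum>j=1..n. Q\<phi> s w j / (s - of_nat j))"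
proof -
  have "Q\<phi> s (w @ [Y]) n = - lin (\<lambda>v. qsum s (ridx (v @ [Y])) n) (phi_word w)"
    by (simp add: Q\<phi>_def lin_phi_word_snoc)
  also have "lin (\<lambda>v. qsum s (ridx (v @ [Y])) n) (phi_word w) =
     lin (\<lambda>v. (\<Sum>j<n. hterm s (ridx (v @ [Y])) j) + (\<Sum>j=1..n. qsum s (ridx v) j / (s - of_nat j))) (phi_word w)"
    by (rule lin_phi_word_cong[OF _ assms]) (simp add: ridx_snoc_Y)
  also have "- \<dots> = (\<Sum>j<n. H\<phi> s (w @ [Y]) j) - (\<Sum>j=1..n. Q\<phi> s w j / (s - of_nat j))"
    by (simp add: lin_divide lin_add_fun lin_sum_fun H\<phi>_def Q\<phi>_def lin_phi_word_snoc sum_negf)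
  also have "(\<Sum>j<n. H\<phi> s (w @ [Y]) j) = (\<Sum>j=1..<n. H\<phi> s (w @ [Y]) j)"
    by (rule sum_lessThan_eq_sum_from_1) (use assms in \<open>auto simp: H\<phi>_snoc_Y\<close>)
  finally show ?thesis .
qed

text \<open>The value \<open>0\<close> at \<open>k = 0\<close> makes the recurrence \<open>hseq_Suc\<close> valid already for \<open>k = 1\<close>.\<close>

definition hseq :: "'b::field_char_0 \<Rightarrow> nat list \<Rightarrow> nat \<Rightarrow> nat \<Rightarrow> 'b" where
  "hseq s u k n = (if k = 0 then 0 else H\<phi> s (word_of_idx (rev (k # u))) n)"

text \<open>For fixed \<open>u\<close>, these give a second-order recurrence h(k+1) = T(s h(k) -
  h(k-1)), where T sends f to 1/n times the sum of f(j)/(s - j) over j from 1 to n.\<close>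

lemma
  assumes s: "\<And>i. s \<noteq> of_nat i" and n: "0 < n"
  shows hseq_one: "of_nat n * hseq s u 1 n = - Q\<phi> s (word_of_idx (rev u)) n" (is ?th1)
    and hseq_Suc: "0 < k \<Longrightarrow> of_nat n * hseq s u (Suc k) n =
       (\<Sum>j=1..n. (s * hseq s u k j - hseq s u (k - 1) j) / (s - of_nat j))" (is "_ \<Longrightarrow> ?th2")
    and Q\<phi>_eq_hseq: "0 < k \<Longrightarrow>
       Q\<phi> s (word_of_idx (rev (k # u))) n = of_nat n * hseq s u (Suc k) n - hseq s u k n" (is "_ \<Longrightarrow> ?th3")
proof -
  define W where "W k = word_of_idx (rev (k # u))" for k
  have W1: "W 1 = word_of_idx (rev u) @ [Y]" by (simp add: W_def word_of_idx_snoc)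
  have W_Suc: "W (Suc k) = W k @ [X]" if "0 < k" for k
    using that by (cases k) (simp_all add: W_def word_of_idx_snoc replicate_append_same)
  have W_H1: "in_H1_word (W k)" "W k \<noteq> []" for k
    by (simp_all add: W_def in_H1_word_of_idx word_of_idx_eq_Nil_iff)
  have h: "hseq s u k n = H\<phi> s (W k) n" if "0 < k" for k n
    using that by (simp add: hseq_def W_def)
  have one: "of_nat n * hseq s u 1 n = - Q\<phi> s (word_of_idx (rev u)) n" if "0 < n" for n
    using that by (simp add: h[of 1, simplified] W1[simplified] H\<phi>_snoc_Y in_H1_word_of_idx)
  show ?th1 using one n .
  have three: "Q\<phi> s (W k) n = of_nat n * hseq s u (Suc k) n - hseq s u k n" if "0 < k" "0 < n" for k n
    using that by (simp add: h W_Suc H\<phi>_snoc_X W_H1)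
  show ?th3 if "0 < k" using three that n by (simp add: W_def)
  \<comment> \<open>The last letter is \<open>Y\<close> for \<open>k = 1\<close> and
    \<open>X\<close> otherwise; \<open>hseq s u 0 j = 0\<close> lets one formula cover both
    cases.\<close>
  have Q: "Q\<phi> s (W k) n = (\<Sum>j=1..<n. hseq s u k j) +
      (\<Sum>j=1..n. (of_nat j * hseq s u k j - hseq s u (k - 1) j) / (s - of_nat j))" if "0 < k" for k
  proof (cases "k = 1")
    case True
    have "Q\<phi> s (W 1) n = (\<Sum>j=1..<n. hseq s u 1 j) + (\<Sum>j=1..n. - Q\<phi> s (word_of_idx (rev u)) j / (s - of_nat j))"
      using W1 by (simp add: h Q\<phi>_snoc_Y in_H1_word_of_idx sum_negf)
    also have "(\<Sum>j=1..n. - Q\<phi> s (word_of_idx (rev u)) j / (s - of_nat j)) =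
      (\<Sum>j=1..n. (of_nat j * hseq s u 1 j - hseq s u 0 j) / (s - of_nat j))"
      by (intro sum.cong refl) (simp add: one[symmetric] hseq_def)
    finally show ?thesis using True by simp
  next
    case False
    with that obtain l where l: "k = Suc l" "0 < l" by (cases k) auto
    have "Q\<phi> s (W k) n = (\<Sum>j=1..<n. hseq s u k j) + (\<Sum>j=1..n. Q\<phi> s (W l) j / (s - of_nat j))"
      using l by (simp add: h Q\<phi>_snoc_X W_H1 W_Suc)
    also have "(\<Sum>j=1..n. Q\<phi> s (W l) j / (s - of_nat j)) =
      (\<Sum>j=1..n. (of_nat j * hseq s u k j - hseq s u (k - 1) j) / (s - of_nat j))"
      using l by (intro sum.cong refl) (simp add: three)
    finally show ?thesis .
  qed
  show ?th2 if "0 < k"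
  proof -
    \<comment> \<open>The term \<open>hseq s u k n\<close> extends the strict sum to
      \<open>j = n\<close>; then \<open>1 + j / (s - j) = s / (s - j)\<close> merges the
      sums.\<close>
    have "of_nat n * hseq s u (Suc k) n = Q\<phi> s (W k) n + hseq s u k n"
      using three[of k n] that n by simp
    also have "\<dots> = (\<Sum>j=1..n. hseq s u k j) + 
      (\<Sum>j=1..n. (of_nat j * hseq s u k j - hseq s u (k - 1) j) / (s - of_nat j))"
      using n by (simp add: Q[OF that] sum.last_plus)
    also have "\<dots> = (\<Sum>j=1..n. (s * hseq s u k j - hseq s u (k - 1) j) / (s - of_nat j))"
      unfolding sum.distrib[symmetric]
    proof (intro sum.cong refl)
      fix j
      have "s - of_nat j \<noteq> 0" using s[of j] by simp
      then show "hseq s u k j + (of_nat j * hseq s u k j - hseq s u (k - 1) j) / (s - of_nat j) =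
        (s * hseq s u k j - hseq s u (k - 1) j) / (s - of_nat j)"
        by (simp add: field_simps)
    qed
    finally show ?thesis .
  qed
qed

text \<open>The sum would be 0 at the empty list, so the value 1 of a character is set
  separately.\<close>

definition Fsum :: "'b::field_char_0 \<Rightarrow> nat \<Rightarrow> nat list \<Rightarrow> 'b" where
  "Fsum s p u = (if u = [] then 1 else
     \<Sum>n=1..p. kker s (of_nat p) n * H\<phi> s (word_of_idx (rev u)) n)"

text \<open>The stage between \<open>p - 1\<close> and \<open>p\<close>: the inverse step with
  \<open>1 / (s - p)\<close> is done, the step with \<open>1 / p\<close> is still to come.\<close>

definition Gsum :: "'b::field_char_0 \<Rightarrow> nat \<Rightarrow> nat list \<Rightarrow> 'b" where
  "Gsum s p u = - of_nat p * (s - of_nat p) *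
     (\<Sum>n=1..p. jker s (of_nat p) n * Q\<phi> s (word_of_idx (rev u)) n)"

text \<open>The sum telescopes to its lower boundary term, where
  \<open>jker s p 1 = -1 / (s - 1)\<close>.\<close>

lemma Gsum_Nil:
  fixes s :: "'b::field_char_0"
  assumes s: "\<And>i. s \<noteq> of_nat i" and p: "0 < p"
  shows "Gsum s p [] = 1"
proof -
  have ne: "s - of_nat p \<noteq> 0" "s - 1 \<noteq> 0" "(of_nat p :: 'b) \<noteq> 0" using s[of p] s[of 1] p by auto
  have "Q\<phi> s [] n = 1" for n by (simp add: Q\<phi>_def)
  then have "Gsum s p [] = - (of_nat p * (s - of_nat p) * (\<Sum>n=1..<Suc p. jker s (of_nat p) n))"
    by (simp add: Gsum_def word_of_idx_def atLeastLessThanSuc_atLeastAtMost del: jker.simps)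
  also have "\<dots> = - (of_nat 1 * (s - of_nat 1) * jker s (of_nat p) 1)"
    using sum_jker[of s "of_nat p" 1 "Suc p"] s[of p] s p jker_eq_0[of p "Suc p" s]
    by (simp del: jker.simps)
  also have "\<dots> = 1" using ne by (simp add: divide_simps)
  finally show ?thesis .
qed


lemma kker_pred_eq:
  fixes s :: "'b::field_char_0"
  assumes "s \<noteq> of_nat (Suc p)"
  shows "kker s (of_nat p) n =
    jker s (of_nat (Suc p)) n * (of_nat (Suc p) - of_nat n) * (s - of_nat (Suc p))"
  using kker_pred_eq_jker[of "of_nat (Suc p)" s n] assms
  by (simp del: of_nat_Suc) (simp add: of_nat_Suc[of p])

text \<open>Pairing the eigenvector with the recurrence in \<open>k\<close> gives scalars
  \<open>y k\<close> with characteristic polynomial (P t - 1)(q t - 1), \<open>q = s - P\<close>.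
  Its roots are the arguments of the two characters.\<close>

lemma
  fixes s :: "'b::field_char_0" and p k :: nat and u :: "nat list"
  assumes s: "\<And>i. s \<noteq> of_nat i" and k: "0 < k"
  defines "P \<equiv> of_nat (Suc p)"
  shows Gsum_Cons: "Gsum s (Suc p) (k # u) = Fsum s p (k # u) - (1 / (s - P)) ^ k * Gsum s (Suc p) u"
    and Fsum_Suc_Cons: "Fsum s (Suc p) (k # u) = Gsum s (Suc p) (k # u) + (1 / P) ^ k * Gsum s (Suc p) u"
proof -
  have P: "P \<noteq> 0" "s \<noteq> P" using s[of "Suc p"] by (simp_all add: P_def del: of_nat_Suc)
  define y where "y k = (\<Sum>n=1..Suc p. of_nat n * jker s P n * hseq s u k n)" for k
  define G where "G = Gsum s (Suc p) u"
  define q where "q = s - P"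
  have q: "q \<noteq> 0" "s = P + q" using P by (simp_all add: q_def)
  have y0: "y 0 = 0" by (simp add: y_def hseq_def)
  have "y 1 = (\<Sum>n=1..Suc p. jker s P n * - Q\<phi> s (word_of_idx (rev u)) n)"
    unfolding y_def
  proof (intro sum.cong refl)
    fix n assume "n \<in> {1..Suc p}"
    then have "of_nat n * hseq s u 1 n = - Q\<phi> s (word_of_idx (rev u)) n"
      using hseq_one[OF s, of n u] by simp
    then show "of_nat n * jker s P n * hseq s u 1 n = jker s P n * - Q\<phi> s (word_of_idx (rev u)) n"
      by (metis mult.assoc mult.commute)
  qed
  then have y1: "P * q * y 1 = G"
    by (simp add: G_def Gsum_def P_def q_def sum_negf del: jker.simps of_nat_Suc sum.cl_ivl_Suc)
  \<comment> \<open>The eigenvector property replaces the operator by the scalar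
    \<open>1 / (P * q)\<close>.\<close>
  have y_rec: "P * q * y (Suc k) = s * y k - y (k - 1)" if "0 < k" for k
  proof -
    have "P * q * y (Suc k) = P * q * (\<Sum>n=1..Suc p. jker s P n *
        (\<Sum>j=1..n. (s * hseq s u k j - hseq s u (k - 1) j) / (s - of_nat j)))"
      unfolding y_def using hseq_Suc[of s _ k u] s that
      by (intro arg_cong[where f = "\<lambda>x. P * q * x"] sum.cong refl) (simp add: mult_ac del: of_nat_Suc jker.simps)
    also have "\<dots> = (\<Sum>j=1..Suc p. of_nat j * jker s P j * (s * hseq s u k j - hseq s u (k - 1) j))"
      unfolding q_def P_def using s by (intro jker_adjoint) auto
    also have "\<dots> = s * y k - y (k - 1)"
      by (simp add: y_def sum_subtractf sum_distrib_left algebra_simps del: sum.cl_ivl_Suc of_nat_Suc jker.simps)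
    finally show ?thesis .
  qed
  \<comment> \<open>As \<open>s = P + q\<close>, the sequence \<open>P * y (Suc k) - y k\<close> is
    geometric with ratio \<open>1 / q\<close>.\<close>
  have y_Suc: "P * q * y (Suc k) = q * y k + (1 / q) ^ k * G" for k
  proof (induction k)
    case (Suc k)
    have "P * q * y (Suc (Suc k)) = s * y (Suc k) - y k"
      using y_rec[of "Suc k"] by simp
    also have "\<dots> = q * y (Suc k) + (P * q * y (Suc k) - q * y k) / q"
      using q by (simp add: field_simps)
    also have "\<dots> = q * y (Suc k) + (1 / q) ^ Suc k * G"
      unfolding Suc by simp
    finally show ?case .
  qed (use y0 y1 in simp)
  have y_closed: "(q - P) * y k = ((1 / P) ^ k - (1 / q) ^ k) * G" for k
  proof (induction k)
    case (Suc k)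
    have "P * ((q - P) * y (Suc k)) = (q - P) / q * (P * q * y (Suc k))"
      using q by simp
    also have "\<dots> = (q - P) * y k + (q - P) * (1 / q) ^ Suc k * G"
      unfolding y_Suc using q by (simp add: field_simps)
    also have "\<dots> = P * (((1 / P) ^ Suc k - (1 / q) ^ Suc k) * G)"
      unfolding Suc using P q by (simp add: field_simps)
    finally show ?case using P by simp
  qed (simp add: y0)
  \<comment> \<open>The factor \<open>P - n\<close> vanishes at \<open>n = Suc p\<close>, so the sum
    may run up to \<open>Suc p\<close>.\<close>
  have F: "Fsum s p (k # u) = (\<Sum>n=1..Suc p. jker s P n * (P - of_nat n) * q * hseq s u k n)"
    using k s[of "Suc p"] kker_pred_eq[of s p]
    by (simp add: Fsum_def P_def[symmetric] q_def hseq_def del: jker.simps of_nat_Suc)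
  have F_Suc: "Fsum s (Suc p) (k # u) = (\<Sum>n=1..Suc p. jker s P n * P * (q - of_nat n) * hseq s u k n)"
    using k kker_eq_jker[of P s] P
    by (simp add: Fsum_def P_def[symmetric] q_def hseq_def del: jker.simps kker.simps of_nat_Suc sum.cl_ivl_Suc)
  have "Gsum s (Suc p) (k # u) = - P * q * (\<Sum>n=1..Suc p. jker s P n * (of_nat n * hseq s u (Suc k) n - hseq s u k n))"
    unfolding Gsum_def P_def[symmetric] q_def[symmetric] using k s
    by (intro arg_cong[where f = "\<lambda>x. - P * q * x"] sum.cong refl) (simp add: Q\<phi>_eq_hseq[OF s] del: jker.simps rev.simps)
  also have "\<dots> = Fsum s p (k # u) - P * q * y (Suc k) + q * y k"
    by (simp add: F y_def sum_subtractf sum_negf sum_distrib_left algebra_simps del: sum.cl_ivl_Suc of_nat_Suc jker.simps)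
  finally show G: "Gsum s (Suc p) (k # u) = Fsum s p (k # u) - (1 / (s - P)) ^ k * Gsum s (Suc p) u"
    using y_Suc[of k] by (simp add: G_def q_def)
  \<comment> \<open>Here \<open>P * (q - n) - (P - n) * q = n * (q - P)\<close> produces the
    eigenvector.\<close>
  have "Fsum s (Suc p) (k # u) = Fsum s p (k # u) + (q - P) * y k"
    by (simp add: F F_Suc y_def sum_subtractf sum_negf sum_distrib_left algebra_simps del: sum.cl_ivl_Suc of_nat_Suc jker.simps)
  then show "Fsum s (Suc p) (k # u) = Gsum s (Suc p) (k # u) + (1 / P) ^ k * Gsum s (Suc p) u"
    unfolding y_closed G G_def by (simp add: algebra_simps q_def)
qed

text \<open>The recursions of \<open>Fsum\<close> and \<open>Gsum\<close> are established for
  positive entries, but a character lives on all lists. So it is built by the two convolution steps,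
  starting from the indicator at \<open>p = 0\<close>.\<close>

lemma harm_char_extending_Fsum:
  assumes s: "\<And>i. s \<noteq> of_nat i"
  obtains f where "harm_char f" "\<And>u. 0 \<notin> set u \<Longrightarrow> f u = Fsum s p u"
proof (induction p arbitrary: thesis)
  case 0
  then show ?case
    using harm_char_indicator[where ?'b = 'a] by (auto simp: Fsum_def)
next
  case (Suc p)
  then obtain f where f: "harm_char f" "\<And>u. 0 \<notin> set u \<Longrightarrow> f u = Fsum s p u" by blast
  define P :: 'a where "P = of_nat (Suc p)"
  define g where "g = rec_list 1 (\<lambda>k u gu. f (k # u) - (1 / (s - P)) ^ k * gu)"
  have g: "g [] = 1" "\<And>k u. g (k # u) = f (k # u) - (1 / (s - P)) ^ k * g u"
    by (simp_all add: g_def)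
  define h where "h = (\<lambda>u. case u of [] \<Rightarrow> 1 | k # u' \<Rightarrow> g (k # u') + (1 / P) ^ k * g u')"
  have h: "h [] = 1" "\<And>k u. h (k # u) = g (k # u) + (1 / P) ^ k * g u"
    by (simp_all add: h_def)
  have gG: "g u = Gsum s (Suc p) u" if "0 \<notin> set u" for u
    using that
  proof (induction u)
    case (Cons k u)
    then show ?case using s f(2)[of "k # u"] unfolding g P_def by (subst Gsum_Cons) auto
  qed (simp add: g Gsum_Nil s)
  have "h u = Fsum s (Suc p) u" if "0 \<notin> set u" for u
  proof (cases u)
    case (Cons k u)
    then show ?thesis using that s unfolding Cons h P_def by (subst Fsum_Suc_Cons) (auto simp: gG)
  qed (simp add: h Fsum_def)
  moreover have "harm_char h"
    using harm_char_step harm_char_inverse_step f(1) g h by blast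
  ultimately show ?case using Suc.prems by blast
qed

section \<open>The finite sums as iterated sums\<close>

fun gsum :: "nat \<Rightarrow> nat list \<Rightarrow> nat \<Rightarrow> rat" where
  "gsum N [] n = 1"
| "gsum N (k # u) n = (\<Sum>j<n. gsum N u j / of_nat j ^ k) +
     (if k = 1 then \<Sum>j=1..n. gsum N u j / of_nat (N - j) else 0)"

definition ones :: "nat list \<Rightarrow> nat set" where
  "ones ks = {i \<in> {1..length ks}. ks ! (i - 1) = 1}"

definition weight :: "nat \<Rightarrow> nat list \<Rightarrow> nat set \<Rightarrow> nat list \<Rightarrow> rat" where
  "weight N ks A ns = (\<Prod>i\<in>A. 1 / of_nat (N - ns ! (i - 1))) *
     (\<Prod>i\<in>{1..length ks} - A. 1 / (of_nat (ns ! (i - 1))) ^ (ks ! (i - 1)))"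

lemma zeta_diamond_N_eq_sum_weight:
  "zeta_diamond_N ks N = (\<Sum>A\<in>Pow (ones ks). \<Sum>ns\<in>S_set (length ks) N A. weight N ks A ns)"
  by (simp add: zeta_diamond_N_def Let_def ones_def weight_def)

lemma finite_S_set: "finite (S_set r N A)"
  by (rule finite_subset[OF _ finite_lists_length_eq[of "{1..N - 1}" r]]) (auto simp: S_set_def)

lemma S_set_snoc_snoc:
  "ms @ [j, n] \<in> S_set (Suc (Suc r)) N B \<longleftrightarrow>
     n \<in> {1..N - 1} \<and> (if Suc r \<in> B then j \<le> n else j < n) \<and> ms @ [j] \<in> S_set (Suc r) N B"
proof (cases "length ms = r")
  case True
  have "{1..Suc r} = insert (Suc r) {1..r}" by auto
  moreover have "(ms @ [j, n]) ! (i - 1) = (ms @ [j]) ! (i - 1)" "(ms @ [j, n]) ! i = (ms @ [j]) ! i"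
    if "i \<in> {1..r}" for i
    using that True by (auto simp: nth_append nth_Cons split: nat.splits)
  moreover have "(ms @ [j, n]) ! (Suc r - 1) = j" "(ms @ [j, n]) ! Suc r = n"
    using True by (auto simp: nth_append)
  ultimately show ?thesis
    using True unfolding S_set_def by (auto simp del: atLeastAtMost_iff)
qed (simp add: S_set_def)

text \<open>A tuple of length \<open>Suc r\<close> has inequalities only at the positions 1 to
  \<open>r\<close>.\<close>

lemma S_set_cong: "A \<inter> {1..r} = B \<inter> {1..r} \<Longrightarrow> S_set (Suc r) N A = S_set (Suc r) N B"
  by (auto simp: S_set_def)

lemma sum_over_snoc:
  fixes f :: "'a list \<Rightarrow> 'b::comm_monoid_add"
  assumes "finite Z" "finite J" "\<And>ns. ns \<in> Z \<Longrightarrow> ns \<noteq> [] \<and> last ns \<in> J"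
  shows "sum f Z = (\<Sum>j\<in>J. \<Sum>ms | ms @ [j] \<in> Z. f (ms @ [j]))"
proof -
  have fin: "finite {ms. ms @ [j] \<in> Z}" for j
    by (rule inj_on_finite[of "\<lambda>ms. ms @ [j]" _ Z]) (auto simp: inj_on_def assms)
  show ?thesis
    unfolding sum.Sigma[OF assms(2) ballI[OF fin]]
    by (rule sum.reindex_bij_witness[of _ "\<lambda>(j, ms). ms @ [j]" "\<lambda>ns. (last ns, butlast ns)"])
      (use assms(3) in fastforce)+
qed

lemma ones_snoc: "ones (ks @ [k]) = (if k = 1 then insert (Suc (length ks)) (ones ks) else ones ks)"
  by (auto simp: ones_def nth_append le_Suc_eq)

lemma weight_snoc:
  assumes "A \<subseteq> {1..length ks}" "length ms = length ks"
  shows "weight N (ks @ [k]) A (ms @ [j]) = weight N ks A ms / of_nat j ^ k"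
    and "weight N (ks @ [k]) (insert (Suc (length ks)) A) (ms @ [j]) = weight N ks A ms / of_nat (N - j)"
proof -
  let ?r = "length ks"
  have A: "finite A" "Suc ?r \<notin> A" using assms finite_subset by auto
  have lt: "i - 1 < ?r" if "i \<in> A" for i using assms that by fastforce
  have 1: "(\<Prod>i\<in>A. 1 / of_nat (N - (ms @ [j]) ! (i - 1))) = (\<Prod>i\<in>A. 1 / (of_nat (N - ms ! (i - 1)) :: rat))"
    using assms lt by (intro prod.cong refl) (auto simp: nth_append)
  have 2: "(\<Prod>i\<in>{1..?r} - A. 1 / (of_nat ((ms @ [j]) ! (i - 1))) ^ ((ks @ [k]) ! (i - 1))) =
      (\<Prod>i\<in>{1..?r} - A. 1 / (of_nat (ms ! (i - 1)) :: rat) ^ (ks ! (i - 1)))"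
    using assms by (intro prod.cong refl) (auto simp: nth_append)
  have 3: "{1..Suc ?r} - A = insert (Suc ?r) ({1..?r} - A)" "{1..Suc ?r} - insert (Suc ?r) A = {1..?r} - A"
    using A by auto
  have fin: "finite ({1..?r} - A)" "Suc ?r \<notin> {1..?r} - A" by auto
  have last: "(ms @ [j]) ! (Suc ?r - 1) = j" "(ks @ [k]) ! (Suc ?r - 1) = k"
    using assms by (simp_all add: nth_append)
  show "weight N (ks @ [k]) A (ms @ [j]) = weight N ks A ms / of_nat j ^ k"
    "weight N (ks @ [k]) (insert (Suc ?r) A) (ms @ [j]) = weight N ks A ms / of_nat (N - j)"
    unfolding weight_def length_append_singleton 3 prod.insert[OF fin] prod.insert[OF A] 1 2 last
    by simp_all
qed

text \<open>\<open>n\<close> serves as an extra last entry bounding the others. Whether the position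
  before it lies in \<open>A\<close> decides between the strict sum with \<open>j ^ k\<close> and
  the weak sum with \<open>N - j\<close>.\<close>

lemma gsum_eq_sum_weight:
  assumes "n \<in> {1..<N}" "0 \<notin> set u"
  shows "gsum N u n = (\<Sum>A\<in>Pow (ones (rev u)). \<Sum>ns | ns @ [n] \<in> S_set (Suc (length u)) N A. weight N (rev u) A ns)"
  using assms
proof (induction u arbitrary: n)
  case Nil
  have "{ns. ns @ [n] \<in> S_set (Suc 0) N {}} = {[]}"
    using Nil by (auto simp: S_set_def)
  then show ?case by (simp add: ones_def weight_def)
next
  case (Cons k u)
  let ?r = "length u" and ?w = "weight N (rev u)"
  define T where "T A j = {ms. ms @ [j] \<in> S_set (Suc ?r) N A}" for A j
  have T_length: "length ms = ?r" if "ms \<in> T A j" for A j ms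
    using that by (simp add: T_def S_set_def)
  have ones: "ones (rev u) \<subseteq> {1..?r}" by (auto simp: ones_def)
  have IH: "gsum N u j = (\<Sum>A\<in>Pow (ones (rev u)). \<Sum>ms\<in>T A j. ?w A ms)" if "j \<in> {1..<N}" for j
    using Cons.IH[of j] that Cons.prems by (simp add: T_def)
  \<comment> \<open>Tuples are sorted by the entry \<open>j\<close> before \<open>n\<close>; its
    position in or outside \<open>B\<close> decides between \<open>j \<le> n\<close> and
    \<open>j < n\<close>.\<close>
  have split: "(\<Sum>ns | ns @ [n] \<in> S_set (Suc (Suc ?r)) N B. f ns) =
      (\<Sum>j\<in>{j\<in>{1..<N}. if Suc ?r \<in> B then j \<le> n else j < n}. \<Sum>ms\<in>T A j. f (ms @ [j]))"
    if AB: "A \<inter> {1..?r} = B \<inter> {1..?r}" for A B and f :: "nat list \<Rightarrow> rat"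
  proof -
    let ?Z = "{ns. ns @ [n] \<in> S_set (Suc (Suc ?r)) N B}"
    have "finite ?Z"
      by (rule inj_on_finite[of "\<lambda>ms. ms @ [n]" _ "S_set (Suc (Suc ?r)) N B"])
        (auto simp: inj_on_def finite_S_set)
    moreover have "ns \<noteq> [] \<and> last ns \<in> {1..<N}" if "ns \<in> ?Z" for ns
      using that last_in_set[of ns] by (fastforce simp: S_set_def)
    ultimately have "sum f ?Z = (\<Sum>j=1..<N. \<Sum>ms | ms @ [j] \<in> ?Z. f (ms @ [j]))"
      by (intro sum_over_snoc) auto
    also have "\<dots> = (\<Sum>j=1..<N. if (if Suc ?r \<in> B then j \<le> n else j < n) then \<Sum>ms\<in>T A j. f (ms @ [j]) else 0)"
    proof (intro sum.cong refl)
      fix j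
      have "{ms. ms @ [j] \<in> ?Z} = (if (if Suc ?r \<in> B then j \<le> n else j < n) then T A j else {})"
        using Cons.prems S_set_cong[OF AB] by (auto simp: S_set_snoc_snoc T_def)
      then show "(\<Sum>ms | ms @ [j] \<in> ?Z. f (ms @ [j])) =
          (if (if Suc ?r \<in> B then j \<le> n else j < n) then \<Sum>ms\<in>T A j. f (ms @ [j]) else 0)"
        by simp
    qed
    finally show ?thesis by (simp only: sum.inter_filter[OF finite_atLeastLessThan])
  qed
  have strict: "(\<Sum>ns | ns @ [n] \<in> S_set (Suc (Suc ?r)) N A. weight N (rev u @ [k]) A ns) =
      (\<Sum>j=1..<n. \<Sum>ms\<in>T A j. ?w A ms / of_nat j ^ k)" if "A \<subseteq> ones (rev u)" for A
  proof -
    have "A \<subseteq> {1..?r}" "Suc ?r \<notin> A" using that ones by auto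
    then show ?thesis
      unfolding split[OF refl] using Cons.prems T_length
      by (intro sum.cong) (auto simp: weight_snoc)
  qed
  have weak: "(\<Sum>ns | ns @ [n] \<in> S_set (Suc (Suc ?r)) N (insert (Suc ?r) A). weight N (rev u @ [k]) (insert (Suc ?r) A) ns) =
      (\<Sum>j=1..n. \<Sum>ms\<in>T A j. ?w A ms / of_nat (N - j))" if "A \<subseteq> ones (rev u)" for A
  proof -
    have "A \<subseteq> {1..?r}" "A \<inter> {1..?r} = insert (Suc ?r) A \<inter> {1..?r}" using that ones by auto
    moreover from this(1) have "weight N (rev u @ [k]) (insert (Suc ?r) A) (ms @ [j]) = ?w A ms / of_nat (N - j)"
      if "ms \<in> T A j" for ms j
      using weight_snoc(2)[of A "rev u" ms N k j] T_length[OF that] by simp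
    ultimately show ?thesis
      unfolding split[OF \<open>A \<inter> {1..?r} = _\<close>] using Cons.prems
      by (intro sum.cong) auto
  qed
  have 1: "(\<Sum>j=1..<n. gsum N u j / of_nat j ^ k) =
      (\<Sum>A\<in>Pow (ones (rev u)). \<Sum>ns | ns @ [n] \<in> S_set (Suc (Suc ?r)) N A. weight N (rev u @ [k]) A ns)"
    using Cons.prems by (simp add: strict IH sum_divide_distrib sum.swap[of _ "Pow _"])
  have 2: "(\<Sum>j=1..n. gsum N u j / of_nat (N - j)) =
      (\<Sum>A\<in>Pow (ones (rev u)). \<Sum>ns | ns @ [n] \<in> S_set (Suc (Suc ?r)) N (insert (Suc ?r) A).
         weight N (rev u @ [k]) (insert (Suc ?r) A) ns)"
    using Cons.prems by (simp add: weak IH sum_divide_distrib sum.swap[of _ "Pow _"])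
  have lt: "(\<Sum>j<n. gsum N u j / of_nat j ^ k) = (\<Sum>j=1..<n. gsum N u j / of_nat j ^ k)"
    by (rule sum.mono_neutral_right) (use Cons.prems in \<open>auto simp: Suc_le_eq intro!: gr0I\<close>)
  have fin: "finite (ones (rev u))" "Suc ?r \<notin> ones (rev u)" using ones finite_subset by auto
  show ?case
  proof (cases "k = 1")
    case True
    \<comment> \<open>The power set splits into the sets without and with the new position, which
      give the strict and the weak sum.\<close>
    have "inj_on (insert (Suc ?r)) (Pow (ones (rev u)))"
      using fin(2) by (intro inj_onI) (metis PowD insert_ident subsetD)
    moreover have "Pow (ones (rev u)) \<inter> insert (Suc ?r) ` Pow (ones (rev u)) = {}"
      using fin by auto
    ultimately show ?thesis
      using True fin lt 1 2
      by (simp add: ones_snoc Pow_insert sum.union_disjoint sum.reindex del: One_nat_def)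
  next
    case False
    then show ?thesis using lt 1 by (simp add: ones_snoc)
  qed
qed

text \<open>As \<open>k \<ge> 2\<close>, the last position never lies in \<open>A\<close>, so the
  outermost variable only carries \<open>1 / j ^ k\<close>.\<close>

lemma zeta_diamond_N_eq_gsum:
  assumes "0 \<notin> set u" "2 \<le> k"
  shows "zeta_diamond_N (rev (k # u)) N = (\<Sum>j=1..<N. gsum N u j / of_nat j ^ k)"
proof -
  let ?r = "length u"
  have ones: "ones (rev u) \<subseteq> {1..?r}" by (auto simp: ones_def)
  have "zeta_diamond_N (rev (k # u)) N =
      (\<Sum>A\<in>Pow (ones (rev u)). \<Sum>ns\<in>S_set (Suc ?r) N A. weight N (rev u @ [k]) A ns)"
    using assms by (simp add: zeta_diamond_N_eq_sum_weight ones_snoc)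
  also have "\<dots> = (\<Sum>A\<in>Pow (ones (rev u)). \<Sum>j=1..<N. (\<Sum>ms | ms @ [j] \<in> S_set (Suc ?r) N A. weight N (rev u) A ms) / of_nat j ^ k)"
  proof (intro sum.cong refl)
    fix A assume "A \<in> Pow (ones (rev u))"
    then have A: "A \<subseteq> {1..?r}" using ones by auto
    have "ns \<noteq> [] \<and> last ns \<in> {1..<N}" if "ns \<in> S_set (Suc ?r) N A" for ns
      using that last_in_set[of ns] by (fastforce simp: S_set_def)
    then have "(\<Sum>ns\<in>S_set (Suc ?r) N A. weight N (rev u @ [k]) A ns) =
        (\<Sum>j=1..<N. \<Sum>ms | ms @ [j] \<in> S_set (Suc ?r) N A. weight N (rev u @ [k]) A (ms @ [j]))"
      by (intro sum_over_snoc finite_S_set) auto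
    also have "\<dots> = (\<Sum>j=1..<N. (\<Sum>ms | ms @ [j] \<in> S_set (Suc ?r) N A. weight N (rev u) A ms) / of_nat j ^ k)"
      unfolding sum_divide_distrib using A
      by (intro sum.cong refl weight_snoc) (auto simp: S_set_def)
    finally show "(\<Sum>ns\<in>S_set (Suc ?r) N A. weight N (rev u @ [k]) A ns) = \<dots>" .
  qed
  also have "\<dots> = (\<Sum>j=1..<N. gsum N u j / of_nat j ^ k)"
    using assms by (simp add: gsum_eq_sum_weight sum_divide_distrib sum.swap[of _ "Pow _"])
  finally show ?thesis .
qed

section \<open>Generating functions\<close>

text \<open>Laurent series provide the field that \<open>lin\<close> and the kernels need;
  \<open>fls_X\<close> is the indeterminate z.\<close>

definition gen :: "(nat \<Rightarrow> rat) \<Rightarrow> rat fls" where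
  "gen f = fps_to_fls (Abs_fps f)"

lemma of_rat_fls: "(of_rat c :: rat fls) = fls_const c"
proof (cases c rule: Rat_cases)
  case (Fract a b)
  then have "c = of_int a / of_int b" by (simp add: Fract_of_int_quotient)
  then show ?thesis by (simp add: of_rat_divide fls_of_int fls_const_divide_const)
qed

lemma gen_eq_iff: "gen f = gen g \<longleftrightarrow> f = g"
  by (simp add: gen_def fun_eq_iff fps_eq_iff)

lemma gen_add: "gen (\<lambda>m. f m + g m) = gen f + gen g"
  by (simp add: gen_def fps_eq_iff flip: fps_to_fls_plus)

lemma gen_scale: "gen (\<lambda>m. c * f m) = of_rat c * gen f"
proof -
  have "Abs_fps (\<lambda>m. c * f m) = fps_const c * Abs_fps f" by (simp add: fps_eq_iff)
  then show ?thesis by (simp add: gen_def of_rat_fls fls_times_fps_to_fls)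
qed

lemma gen_zero: "gen (\<lambda>m. 0) = 0"
  by (simp add: gen_def fps_eq_iff)

lemma gen_sum: "gen (\<lambda>m. \<Sum>i\<in>I. f i m) = (\<Sum>i\<in>I. gen (f i))"
  by (induction I rule: infinite_finite_induct) (simp_all add: gen_add gen_zero)

lemma gen_lin: "gen (\<lambda>m. lin (\<lambda>v. f v m) p) = lin (\<lambda>v. gen (f v)) p"
  by (simp add: lin_def gen_sum gen_scale)

lemma gen_shift: "gen (\<lambda>m. if m = 0 then 0 else f (m - 1)) = fls_X * gen f"
proof -
  have "Abs_fps (\<lambda>m. if m = 0 then 0 else f (m - 1)) = fps_X * Abs_fps f" by (simp add: fps_eq_iff)
  then show ?thesis by (simp add: gen_def fls_times_fps_to_fls)
qed

lemma gen_mult: "gen f * gen g = gen (\<lambda>m. \<Sum>i=0..m. f i * g (m - i))"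
proof -
  have "Abs_fps f * Abs_fps g = Abs_fps (\<lambda>m. \<Sum>i=0..m. f i * g (m - i))"
    by (simp add: fps_eq_iff fps_mult_nth)
  then show ?thesis by (simp add: gen_def flip: fls_times_fps_to_fls)
qed

text \<open>The coefficients of z are -1 and 0. Hence s = N - z is a permitted parameter for the
  character.\<close>

lemma of_nat_minus_fls_X_neq: "(of_nat N - fls_X :: rat fls) \<noteq> of_nat i"
proof
  assume "(of_nat N - fls_X :: rat fls) = of_nat i"
  then have "fls_nth (of_nat N - fls_X :: rat fls) 1 = fls_nth (of_nat i) 1" by simp
  then show False by (simp add: fls_of_nat_nth)
qed

section \<open>Harmonic products with powers of \<open>y\<close> and their generating
  functions\<close>

definition gcoef :: "nat \<Rightarrow> nat list \<Rightarrow> nat \<Rightarrow> nat \<Rightarrow> rat" where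
  "gcoef N u n m = lin (\<lambda>v. gsum N v n) (st u (replicate m 1))"

lemma lin_gsum_Cons_Suc:
  "lin (\<lambda>w. gsum N (k # w) (Suc n)) p = lin (\<lambda>w. gsum N (k # w) n) p +
     lin (\<lambda>w. gsum N w n) p / of_nat n ^ k +
     (if k = 1 then lin (\<lambda>w. gsum N w (Suc n)) p / of_nat (N - Suc n) else 0)"
proof -
  have "(\<lambda>w. gsum N (k # w) (Suc n)) = (\<lambda>w. gsum N (k # w) n + gsum N w n / of_nat n ^ k +
     (if k = 1 then gsum N w (Suc n) / of_nat (N - Suc n) else 0))"
    by (simp add: fun_eq_iff)
  then show ?thesis
    by (cases "k = 1") (simp_all add: lin_add_fun lin_divide del: gsum.simps)
qed

lemma gcoef_Nil_Suc:
  "gcoef N [] (Suc n) m = gcoef N [] n m + (if m = 0 then 0 else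
     gcoef N [] n (m - 1) / of_nat n + gcoef N [] (Suc n) (m - 1) / of_nat (N - Suc n))"
  by (cases m) (simp_all add: gcoef_def)

text \<open>The increment in \<open>n\<close> is taken in the three parts of the harmonic recursion,
  with heads \<open>k\<close>, 1 and \<open>k + 1\<close>. Only heads equal to 1 contribute a term
  with \<open>N - Suc n\<close>.\<close>

lemma gcoef_Cons_Suc:
  assumes "0 < k"
  shows "gcoef N (k # u) (Suc n) m = gcoef N (k # u) n m + gcoef N u n m / of_nat n ^ k +
     (if k = 1 then gcoef N u (Suc n) m / of_nat (N - Suc n) else 0) +
     (if m = 0 then 0 else gcoef N (k # u) n (m - 1) / of_nat n +
       gcoef N (k # u) (Suc n) (m - 1) / of_nat (N - Suc n) +
       gcoef N u n (m - 1) / of_nat n ^ Suc k)"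
proof (cases m)
  case 0
  then show ?thesis
    using lin_gsum_Cons_Suc[of N k n "Poly_Mapping.single u 1"] by (simp add: gcoef_def del: gsum.simps)
next
  case (Suc l)
  then show ?thesis
    using assms
    by (simp add: gcoef_def lin_st_cons lin_gsum_Cons_Suc del: gsum.simps st.simps) 
qed

lemma gsum_Cons_0: "gsum N (k # u) 0 = 0"
  by simp

lemma gcoef_Cons_0: "gcoef N (k # u) 0 m = 0"
  by (cases m) (simp_all add: gcoef_def lin_st_cons gsum_Cons_0 del: gsum.simps(2) st.simps(3))

text \<open>For \<open>n < N\<close> this is the generating function of \<open>gcoef N [] n\<close>,
  the contribution of the powers of \<open>y\<close> alone.\<close>

fun pprod :: "nat \<Rightarrow> nat \<Rightarrow> rat fls" where
  "pprod N 0 = 1"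
| "pprod N (Suc n) = pprod N n * (1 + fls_X / of_nat n) / (1 - fls_X / of_nat (N - Suc n))"

lemma gen_divide: "gen (\<lambda>m. f m / c) = gen f / of_rat c"
  using gen_scale[of "inverse c" f] by (simp add: divide_inverse of_rat_inverse mult.commute)

text \<open>The factorization turns \<open>N - j\<close> into \<open>s - j\<close> for s = N - z,
  which is how \<open>gsum\<close> becomes \<open>qsum\<close>.\<close>

lemma one_minus_X_div:
  assumes "Suc n < N"
  shows "1 - fls_X / of_nat (N - Suc n) \<noteq> (0 :: rat fls)"
    "of_nat N - fls_X - of_nat (Suc n) = (of_nat (N - Suc n) * (1 - fls_X / of_nat (N - Suc n)) :: rat fls)"
proof -
  have ne: "(of_nat (N - Suc n) :: rat fls) \<noteq> 0"
    using assms unfolding of_nat_eq_0_iff by simp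
  show 1: "of_nat N - fls_X - of_nat (Suc n) = (of_nat (N - Suc n) * (1 - fls_X / of_nat (N - Suc n)) :: rat fls)"
    using assms ne by (simp add: right_diff_distrib of_nat_diff del: of_nat_Suc)
  show "1 - fls_X / of_nat (N - Suc n) \<noteq> (0 :: rat fls)"
  proof
    assume "1 - fls_X / of_nat (N - Suc n) = (0 :: rat fls)"
    with 1 have "of_nat N - fls_X = (of_nat (Suc n) :: rat fls)" by simp
    then show False using of_nat_minus_fls_X_neq by blast
  qed
qed

text \<open>The powers of \<open>y\<close> split off the factor \<open>pprod\<close>, common to all
  \<open>u\<close>, and shift \<open>N\<close> to N - z in the weak sums. Both sides have the same
  increments in \<open>n\<close>.\<close>

lemma gen_gcoef:
  assumes "0 \<notin> set u" "n < N"
  shows "gen (gcoef N u n) = pprod N n * qsum (of_nat N - fls_X) u n"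
  using assms
proof (induction u arbitrary: n)
  case Nil
  from Nil(2) show ?case
  proof (induction n)
    case 0
    have "gcoef N [] 0 = (\<lambda>m. if m = 0 then 1 else 0)"
    proof
      fix m show "gcoef N [] 0 m = (if m = 0 then 1 else 0)"
        by (cases m) (simp_all add: gcoef_def)
    qed
    moreover have "Abs_fps (\<lambda>m. if m = 0 then 1 else (0::rat)) = 1"
      by (simp add: fps_eq_iff)
    ultimately show ?case by (simp add: gen_def)
  next
    case (Suc n)
    let ?c = "1 - fls_X / of_nat (N - Suc n) :: rat fls"
    have "gen (gcoef N [] (Suc n)) = gen (\<lambda>m. gcoef N [] n m + (if m = 0 then 0 else
       (\<lambda>m. gcoef N [] n m / of_nat n + gcoef N [] (Suc n) m / of_nat (N - Suc n)) (m - 1)))"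
      by (intro arg_cong[where f = gen] ext) (simp add: gcoef_Nil_Suc)
    also have "\<dots> = gen (gcoef N [] n) + fls_X * (gen (gcoef N [] n) / of_nat n +
        gen (gcoef N [] (Suc n)) / of_nat (N - Suc n))"
      by (simp only: gen_add gen_divide of_rat_of_nat_eq
          gen_shift[of "\<lambda>m. gcoef N [] n m / of_nat n + gcoef N [] (Suc n) m / of_nat (N - Suc n)"])
    finally have "gen (gcoef N [] (Suc n)) * ?c = gen (gcoef N [] n) * (1 + fls_X / of_nat n)"
      by (simp add: algebra_simps)
    then have "gen (gcoef N [] (Suc n)) = gen (gcoef N [] n) * (1 + fls_X / of_nat n) / ?c"
      using one_minus_X_div(1)[OF Suc.prems] by (simp add: eq_divide_eq)
    then show ?case using Suc by simp
  qed
next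
  case (Cons k u)
  then have k: "0 < k" and u: "0 \<notin> set u" by auto
  note IH = Cons.IH[OF u]
  let ?s = "of_nat N - fls_X :: rat fls"
  from Cons.prems(2) show ?case
  proof (induction n)
    case 0
    then show ?case using gen_zero by (simp add: gcoef_Cons_0 [abs_def])
  next
    case (Suc n)
    define b :: "rat fls" where "b = of_nat (N - Suc n)"
    let ?c = "1 - fls_X / b"
    let ?g = "\<lambda>n. gen (gcoef N u n)" and ?h = "\<lambda>n. gen (gcoef N (k # u) n)"
    have c: "?c \<noteq> 0" "b \<noteq> 0" using one_minus_X_div(1)[OF Suc.prems] Suc.prems by (simp_all add: b_def del: of_nat_diff)
    have P: "pprod N (Suc n) * ?c = pprod N n * (1 + fls_X / of_nat n)"
      using c by (simp add: b_def)
    define \<delta> :: rat where "\<delta> = (if k = 1 then 1 else 0)"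
    have "?h (Suc n) = gen (\<lambda>m. (gcoef N (k # u) n m + gcoef N u n m / of_nat n ^ k +
         \<delta> * (gcoef N u (Suc n) m / of_nat (N - Suc n))) + (if m = 0 then 0 else
       (\<lambda>m. gcoef N (k # u) n m / of_nat n + gcoef N (k # u) (Suc n) m / of_nat (N - Suc n) +
         gcoef N u n m / of_nat n ^ Suc k) (m - 1)))"
      by (intro arg_cong[where f = gen] ext) (simp add: gcoef_Cons_Suc[OF k] \<delta>_def)
    also have "\<dots> = ?h n + ?g n / of_nat n ^ k + of_rat \<delta> * (?g (Suc n) / b) +
        fls_X * (?h n / of_nat n + ?h (Suc n) / b + ?g n / of_nat n ^ Suc k)"
      by (simp only: gen_add gen_scale gen_divide of_rat_of_nat_eq of_rat_power b_def
          gen_shift[of "\<lambda>m. gcoef N (k # u) n m / of_nat n + gcoef N (k # u) (Suc n) m / of_nat (N - Suc n) +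
            gcoef N u n m / of_nat n ^ Suc k"])
    \<comment> \<open>\<open>?h (Suc n)\<close> also occurs on the right with factor
      \<open>fls_X / b\<close>; moving it over produces \<open>?c\<close>.\<close>
    finally have "?h (Suc n) * ?c = ?h n * (1 + fls_X / of_nat n) +
        ?g n / of_nat n ^ k * (1 + fls_X / of_nat n) + of_rat \<delta> * (?g (Suc n) / b)"
      by (simp add: algebra_simps add_divide_distrib)
    also have "?h n = pprod N n * qsum ?s (k # u) n"
      using Suc by (simp del: qsum.simps)
    also have "?g n = pprod N n * qsum ?s u n"
      using IH Suc.prems by simp
    also have "?g (Suc n) = pprod N (Suc n) * qsum ?s u (Suc n)"
      using IH Suc.prems by simp
    also have "pprod N n * qsum ?s (k # u) n * (1 + fls_X / of_nat n) +
        pprod N n * qsum ?s u n / of_nat n ^ k * (1 + fls_X / of_nat n) +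
        of_rat \<delta> * (pprod N (Suc n) * qsum ?s u (Suc n) / b) =
       pprod N n * (1 + fls_X / of_nat n) * (qsum ?s (k # u) n + qsum ?s u n / of_nat n ^ k) +
        of_rat \<delta> * (pprod N (Suc n) * qsum ?s u (Suc n) / b)"
      by (simp add: distrib_left distrib_right mult_ac)
    also have "\<dots> = pprod N (Suc n) * (qsum ?s (k # u) n + qsum ?s u n / of_nat n ^ k +
        of_rat \<delta> * (qsum ?s u (Suc n) / (b * ?c))) * ?c"
      unfolding P[symmetric] using c by (simp add: distrib_left distrib_right mult_ac del: pprod.simps qsum.simps)
    also have "qsum ?s (k # u) n + qsum ?s u n / of_nat n ^ k +
        of_rat \<delta> * (qsum ?s u (Suc n) / (b * ?c)) = qsum ?s (k # u) (Suc n)"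
      using one_minus_X_div(2)[OF Suc.prems] by (simp add: \<delta>_def b_def del: of_nat_Suc)
    finally show ?case by (simp only: mult_right_cancel[OF c(1)])
  qed
qed

text \<open>For p = N - 1 and s = N - z one has s - 1 - p = -z, whose falling factorial is, up to
  sign, z(z+1)...(z+n-1).\<close>

lemma kker_eq_pprod:
  assumes "0 < n" "n < N"
  shows "fls_X * pprod N n / of_nat n = kker (of_nat N - fls_X) (of_nat (N - 1)) n"
  using assms
proof (induction n)
  case (Suc n)
  let ?k = "kker (of_nat N - fls_X) (of_nat (N - 1))" and ?c = "1 - fls_X / of_nat (N - Suc n) :: rat fls"
  note c = one_minus_X_div[OF Suc.prems(2)]
  have ne: "(of_nat (N - Suc n) :: rat fls) \<noteq> 0"
    using Suc.prems unfolding of_nat_eq_0_iff by simp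
  have "?k (Suc n) = ?k n * of_nat (N - Suc n) * (fls_X + of_nat n) / (of_nat (Suc n) * (of_nat (N - Suc n) * ?c))"
    unfolding kker.simps c(2) using Suc.prems by (simp add: of_nat_diff algebra_simps)
  also have "\<dots> = ?k n * (fls_X + of_nat n) / (of_nat (Suc n) * ?c)"
    using ne by (simp del: of_nat_diff)
  also have "\<dots> = fls_X * pprod N (Suc n) / of_nat (Suc n)"
  \<comment> \<open>At \<open>n = 0\<close> the claim fails, since division by 0 gives 0; so
    \<open>Suc n = 1\<close> is checked directly.\<close>
  proof (cases n)
    case (Suc l)
    then have n: "(of_nat n :: rat fls) \<noteq> 0" unfolding of_nat_eq_0_iff by simp
    have "?k n * (fls_X + of_nat n) = fls_X * pprod N n * (1 + fls_X / of_nat n)"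
      using Suc.IH Suc Suc.prems n by (simp add: field_simps flip: Suc.IH del: pprod.simps kker.simps)
    then show ?thesis by (simp add: mult_ac)
  qed simp
  finally show ?case ..
qed simp


text \<open>The product with y^(m+1) raises the last entry to \<open>Suc k \<ge> 2\<close> and
  multiplies the rest harmonically by y^m, so all resulting indices are admissible.\<close>

lemma lin_Zd_circ_word:
  assumes v: "in_H1_word v" "v \<noteq> []" "ridx v = k # u"
  shows "lin (\<lambda>w. Zd_word w N) (circ_word v (replicate (Suc m) Y)) =
    (\<Sum>j=1..<N. gcoef N u j m / of_nat j ^ Suc k)"
proof -
  have hd: "hd v = Y" using v by (auto simp: in_H1_word_def)
  have ku: "0 < k" "0 \<notin> set u"
    using zero_notin_idx[of v] v(3) by (metis list.set_intros gr0I set_rev)+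
  have "word_of_idx (replicate l 1) = replicate l Y" for l
    by (induction l) (simp_all add: word_of_idx_def)
  then have "idx (replicate l Y) = replicate l 1" for l
    using idx_word_of_idx[of "replicate l 1"] by simp
  then have "circ_word v (replicate (Suc m) Y) = rev_idx_to_H (circ_rev (k # u) (1 # replicate m 1))"
    using v hd by (simp add: circ_word_def flip: replicate_Suc)
  then have "lin (\<lambda>w. Zd_word w N) (circ_word v (replicate (Suc m) Y)) =
      lin (\<lambda>w. Zd_word (word_of_idx (rev (Suc k # w))) N) (st u (replicate m 1))"
    by (simp add: lin_rev_idx_to_H lin_cons_all)
  also have "\<dots> = lin (\<lambda>w. \<Sum>j=1..<N. gsum N w j / of_nat j ^ Suc k) (st u (replicate m 1))"
  proof (rule lin_st_cong[OF _ ku(2)])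
    fix w :: "nat list" assume w: "0 \<notin> set w"
    let ?w = "word_of_idx (rev (Suc k # w))"
    have "last ?w = X" using ku by (simp add: word_of_idx_snoc)
    then have "in_H0_word ?w" "?w \<noteq> []"
      using in_H1_word_of_idx[of "rev (Suc k # w)"] word_of_idx_eq_Nil_iff[of "rev (Suc k # w)"]
      by (auto simp: in_H0_word_def in_H1_word_def)
    then have "Zd_word ?w N = zeta_diamond_N (rev (Suc k # w)) N"
      using idx_word_of_idx[of "rev (Suc k # w)"] w by (simp add: Zd_word_def)
    also have "\<dots> = (\<Sum>j=1..<N. gsum N w j / of_nat j ^ Suc k)"
      using w ku by (intro zeta_diamond_N_eq_gsum) auto
    finally show "Zd_word ?w N = \<dots>" .
  qed simp
  also have "\<dots> = (\<Sum>j=1..<N. gcoef N u j m / of_nat j ^ Suc k)"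
    by (simp only: lin_sum_fun lin_divide gcoef_def)
  finally show ?thesis .
qed

section \<open>The generating function of the theorem as a character\<close>

definition Zgen :: "nat \<Rightarrow> H \<Rightarrow> rat fls" where
  "Zgen N p = gen (\<lambda>m. if m = 0 then 0 else Zd (circ (phi p) (ypow m)) N)"

lemma Zd_circ_phi: "Zd (circ (phi p) (ypow m)) N =
    lin (\<lambda>w. lin (\<lambda>v. lin (\<lambda>x. Zd_word x N) (circ_word v (replicate m Y))) (phi_word w)) p"
  by (simp add: Zd_eq_lin circ_def lin_bilinext phi_def lin_linext ypow_def)

lemma Zgen_eq_lin: "Zgen N p = lin (\<lambda>w. Zgen N (Poly_Mapping.single w 1)) p"
proof -
  have "Zgen N p = gen (\<lambda>m. lin (\<lambda>w. if m = 0 then 0 else Zd (circ (phi (Poly_Mapping.single w 1)) (ypow m)) N) p)"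
    unfolding Zgen_def by (intro arg_cong[where f = gen] ext) (simp add: Zd_circ_phi)
  then show ?thesis by (simp only: gen_lin Zgen_def)
qed

text \<open>The factor z from the index shift and one factor \<open>1 / n\<close> complete
  \<open>pprod\<close> to the kernel; the remaining \<open>1 / n ^ k\<close> completes
  \<open>qsum\<close> to \<open>hterm\<close>.\<close>

lemma Zgen_single:
  assumes "in_H1_word w" "w \<noteq> []"
  shows "Zgen N (Poly_Mapping.single w 1) = Fsum (of_nat N - fls_X) (N - 1) (ridx w)"
proof -
  let ?s = "of_nat N - fls_X :: rat fls"
  have gen_word: "gen (\<lambda>m. if m = 0 then 0 else lin (\<lambda>x. Zd_word x N) (circ_word v (replicate m Y))) =
      (\<Sum>n=1..N - 1. kker ?s (of_nat (N - 1)) n * hterm ?s (ridx v) n)"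
    if v: "in_H1_word v" "w \<noteq> [] \<Longrightarrow> v \<noteq> []" for v
  proof -
    obtain k u where ku: "ridx v = k # u" "0 < k" "0 \<notin> set u"
      using ridx_snoc_X v assms(2) by metis
    have "gen (\<lambda>m. if m = 0 then 0 else lin (\<lambda>x. Zd_word x N) (circ_word v (replicate m Y))) =
        gen (\<lambda>m. if m = 0 then 0 else (\<lambda>m. \<Sum>j=1..<N. gcoef N u j m / of_nat j ^ Suc k) (m - 1))"
    proof (intro arg_cong[where f = gen] ext)
      fix m show "(if m = 0 then 0 else lin (\<lambda>x. Zd_word x N) (circ_word v (replicate m Y))) =
          (if m = 0 then 0 else (\<lambda>m. \<Sum>j=1..<N. gcoef N u j m / of_nat j ^ Suc k) (m - 1))"
        using lin_Zd_circ_word[OF v(1) v(2)[OF assms(2)] ku(1), of N "m - 1"] by (cases m) simp_all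
    qed
    also have "\<dots> = fls_X * (\<Sum>j=1..<N. gen (gcoef N u j) / of_nat j ^ Suc k)"
      by (simp only: gen_sum gen_divide of_rat_of_nat_eq of_rat_power
          gen_shift[of "\<lambda>m. \<Sum>j=1..<N. gcoef N u j m / of_nat j ^ Suc k"])
    also have "\<dots> = (\<Sum>j=1..<N. kker ?s (of_nat (N - 1)) j * hterm ?s (ridx v) j)"
      unfolding sum_distrib_left
    proof (intro sum.cong refl)
      fix j assume j: "j \<in> {1..<N}"
      then have "gen (gcoef N u j) = pprod N j * qsum ?s u j" using gen_gcoef ku by simp
      moreover have "kker ?s (of_nat (N - 1)) j = fls_X * pprod N j / of_nat j"
        using kker_eq_pprod[of j N] j by simp
      ultimately show "fls_X * (gen (gcoef N u j) / of_nat j ^ Suc k) = kker ?s (of_nat (N - 1)) j * hterm ?s (ridx v) j"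
        by (simp add: ku)
    qed
    also have "{1..<N} = {1..N - 1}" by auto
    finally show ?thesis .
  qed
  have "Zgen N (Poly_Mapping.single w 1) = gen (\<lambda>m. lin (\<lambda>v. if m = 0 then 0 else
      lin (\<lambda>x. Zd_word x N) (circ_word v (replicate m Y))) (phi_word w))"
    unfolding Zgen_def by (intro arg_cong[where f = gen] ext) (simp add: Zd_circ_phi)
  also have "\<dots> = lin (\<lambda>v. gen (\<lambda>m. if m = 0 then 0 else
      lin (\<lambda>x. Zd_word x N) (circ_word v (replicate m Y)))) (phi_word w)"
    by (rule gen_lin)
  also have "\<dots> = lin (\<lambda>v. \<Sum>n=1..N - 1. kker ?s (of_nat (N - 1)) n * hterm ?s (ridx v) n) (phi_word w)"
    by (rule lin_phi_word_cong[OF gen_word assms(1)])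
  also have "\<dots> = (\<Sum>n=1..N - 1. kker ?s (of_nat (N - 1)) n * H\<phi> ?s w n)"
    by (simp only: lin_sum_fun lin_mult_left H\<phi>_def)
  also have "\<dots> = Fsum ?s (N - 1) (ridx w)"
    using word_of_idx_idx[OF assms(1)] assms(2)
    by (auto simp: Fsum_def word_of_idx_def)
  finally show ?thesis .
qed

text \<open>By bilinearity it suffices to treat nonempty words of H^1, on which \<open>Zgen\<close>
  is given by a character.\<close>

lemma Zgen_harm:
  assumes "w1 \<in> yH" "w2 \<in> yH"
  shows "Zgen N (harm w1 w2) = Zgen N w1 * Zgen N w2"
proof -
  let ?Z = "\<lambda>w. Zgen N (Poly_Mapping.single w 1)"
  obtain f where f: "harm_char f" "\<And>u. 0 \<notin> set u \<Longrightarrow> f u = Fsum (of_nat N - fls_X :: rat fls) (N - 1) u"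
    using harm_char_extending_Fsum of_nat_minus_fls_X_neq by metis
  have keys: "in_H1_word w \<and> w \<noteq> []" if "w \<in> Poly_Mapping.keys p" "p \<in> yH" for w p
    using that by (auto simp: yH_def in_H1_word_def)
  have Zf: "?Z w = f (ridx w)" if "in_H1_word w" "w \<noteq> []" for w
    using that by (simp add: Zgen_single f zero_notin_idx)
  have word: "lin ?Z (harm_word u v) = ?Z u * ?Z v"
    if u: "in_H1_word u" "u \<noteq> []" and v: "in_H1_word v" "v \<noteq> []" for u v
  proof -
    have "lin ?Z (harm_word u v) = lin (\<lambda>w. ?Z (word_of_idx (rev w))) (st (ridx u) (ridx v))"
      using u v by (simp add: harm_word_def lin_rev_idx_to_H)
    also have "\<dots> = lin f (st (ridx u) (ridx v))"
    proof (rule lin_st_cong)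
      have ne: "ridx u \<noteq> []" using u word_of_idx_idx[of u] by (auto simp: word_of_idx_def)
      fix w :: "nat list" assume w: "0 \<notin> set w" "ridx u \<noteq> [] \<or> ridx v \<noteq> [] \<Longrightarrow> w \<noteq> []"
      then show "?Z (word_of_idx (rev w)) = f w"
        using Zf[of "word_of_idx (rev w)"] ne
        by (simp add: in_H1_word_of_idx word_of_idx_eq_Nil_iff idx_word_of_idx)
    qed (simp_all add: zero_notin_idx)
    also have "\<dots> = ?Z u * ?Z v"
      using f(1) by (simp add: harm_char_def Zf u v)
    finally show ?thesis .
  qed
  have "Zgen N (harm w1 w2) = lin (\<lambda>u. lin (\<lambda>v. lin ?Z (harm_word u v)) w2) w1"
    by (subst Zgen_eq_lin) (simp add: harm_def lin_bilinext)
  also have "\<dots> = lin (\<lambda>u. lin (\<lambda>v. ?Z u * ?Z v) w2) w1"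
    using keys assms by (intro lin_cong_keys) (simp add: word)
  also have "\<dots> = lin ?Z w1 * lin ?Z w2"
    by (simp only: lin_mult_left lin_mult_right)
  finally show ?thesis
    by (simp flip: Zgen_eq_lin)
qed

theorem mainTheorem8:
  fixes m :: nat and w1 w2 :: H
  assumes "m \<ge> 1" and "w1 \<in> yH" and "w2 \<in> yH"
  shows "\<forall>N\<ge>1. (\<Sum>a\<in>{1..<m}. Zd (circ (phi w1) (ypow a)) N * Zd (circ (phi w2) (ypow (m - a))) N)
           = Zd (circ (phi (harm w1 w2)) (ypow m)) N"
proof (intro allI impI)
  fix N :: nat
  define z where "z p m = (if m = 0 then 0 else Zd (circ (phi p) (ypow m)) N)" for p m
  have "gen (\<lambda>m. \<Sum>i=0..m. z w1 i * z w2 (m - i)) = gen (z (harm w1 w2))"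
    using Zgen_harm[OF assms(2,3), of N] by (simp add: Zgen_def gen_mult z_def [abs_def])
  then have "(\<Sum>i=0..m. z w1 i * z w2 (m - i)) = z (harm w1 w2) m"
    unfolding gen_eq_iff by (rule fun_cong)
  \<comment> \<open>The terms \<open>i = 0\<close> and \<open>i = m\<close> vanish because
    \<open>z\<close> is 0 at exponent 0.\<close>
  moreover have "(\<Sum>i=0..m. z w1 i * z w2 (m - i)) = (\<Sum>i=1..<m. z w1 i * z w2 (m - i))"
    by (rule sum.mono_neutral_right) (auto simp: z_def)
  ultimately show "(\<Sum>a\<in>{1..<m}. Zd (circ (phi w1) (ypow a)) N * Zd (circ (phi w2) (ypow (m - a))) N)
           = Zd (circ (phi (harm w1 w2)) (ypow m)) N"
    using assms(1) by (simp add: z_def)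
qed

end
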